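(* Let $T\in\mathcal{B}(\mathcal{H})$ be a contraction whose stable component $T_{00}$ satisfies: (i) $\sigma_p(T_{00}^* )\subseteq\{\bar\lambda:\lambda\in\sigma_p(T_{00})\}$, and (ii) $T_{00}^*$ has a generating root subspace system. Then the commutant mapping $\gamma_T$ is injective if and only if $\sigma_p(T)\cap\{\bar\lambda:\lambda\in\sigma_p(T^* )\}\cap\mathbb{D}=\emptyset$.
   Context: For a contraction $T$, $A_T$ is the strong-operator limit of $T^{*n}T^n$, $\mathcal{H}_0=\{x:\|T^nx\|\to0\}=\ker A_T$, $P_0$ the orthogonal projection onto $\mathcal{H}_0$ and $T_{00}=P_0T|\mathcal{H}_0$. Commutant mapping: let $X_T:\mathcal{H}\to\mathcal{K}_T$, $x\mapsto A_T^{1/2}x$ (with $\overline{\operatorname{ran}A_T}\subseteq\mathcal{K}_T$), where $W_T$ on $\mathcal{K}_T$ is the minimal unitary dilation of the unique isometry $V_T$ on $\overline{\operatorname{ran}A_T}$ satisfying $A_T^{1/2}T=V_TA_T^{1/2}$; then $X_TT=W_TX_T$, and $\gamma_T:\{T\}'\to\{W_T\}'$ maps $C$ to the unique $D\in\{W_T\}'$ with $X_TC=DX_T$. For an operator $B$ on $\mathcal{F}$, the root subspace at $\lambda$ is $\bigvee_{j\ge1}\ker(B-\lambda I)^j$, and $B$ has a generating root subspace system if $\mathcal{F}$ is the closed span of the root subspaces at all $\lambda\in\sigma_p(B)$. $\mathbb{D}$ is the open unit disc. *)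

theory Defs
  imports "HOL-Analysis.Analysis"
begin

class chilbert = real_normed_vector + complete_space +
  fixes scaleC :: "complex \<Rightarrow> 'a \<Rightarrow> 'a"
    and cinner :: "'a \<Rightarrow> 'a \<Rightarrow> complex"
  assumes scaleC_add_right: "scaleC a (x + y) = scaleC a x + scaleC a y"
    and scaleC_add_left: "scaleC (a + b) x = scaleC a x + scaleC b x"
    and scaleC_scaleC: "scaleC a (scaleC b x) = scaleC (a * b) x"
    and scaleC_one: "scaleC 1 x = x"
    and scaleR_scaleC: "scaleR r x = scaleC (complex_of_real r) x"
    and cinner_add_left: "cinner (x + y) z = cinner x z + cinner y z"
    and cinner_scaleC_left: "cinner (scaleC a x) y = cnj a * cinner x y"
    and cinner_commute: "cinner x y = cnj (cinner y x)"
    and norm_cinner: "norm x = sqrt (Re (cinner x x))"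

definition cblinop :: "('a::chilbert \<Rightarrow> 'b::chilbert) \<Rightarrow> bool" where
  "cblinop T \<longleftrightarrow> (\<forall>x y. T (x + y) = T x + T y) \<and> (\<forall>c x. T (scaleC c x) = scaleC c (T x))
      \<and> (\<exists>K. \<forall>x. norm (T x) \<le> K * norm x)"

definition cadj :: "('a::chilbert \<Rightarrow> 'a) \<Rightarrow> ('a \<Rightarrow> 'a)" where
  "cadj T = (THE S. \<forall>x y. cinner (T x) y = cinner x (S y))"

definition contraction :: "('a::chilbert \<Rightarrow> 'a) \<Rightarrow> bool" where
  "contraction T \<longleftrightarrow> cblinop T \<and> (\<forall>x. norm (T x) \<le> norm x)"

definition cspan :: "'a::chilbert set \<Rightarrow> 'a set" where
  "cspan A = {\<Sum>x\<in>F. scaleC (c x) x | F c. finite F \<and> F \<subseteq> A}"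

definition clspan :: "'a::chilbert set \<Rightarrow> 'a set" where
  "clspan A = closure (cspan A)"

definition cproj :: "'a::chilbert set \<Rightarrow> 'a \<Rightarrow> 'a" where
  "cproj M x = (THE y. y \<in> M \<and> (\<forall>z\<in>M. cinner z (x - y) = 0))"

definition cpositive :: "('a::chilbert \<Rightarrow> 'a) \<Rightarrow> bool" where
  "cpositive B \<longleftrightarrow> cblinop B \<and> (\<forall>x. Im (cinner x (B x)) = 0 \<and> 0 \<le> Re (cinner x (B x)))"

definition csqrt_op :: "('a::chilbert \<Rightarrow> 'a) \<Rightarrow> ('a \<Rightarrow> 'a)" where
  "csqrt_op A = (THE B. cpositive B \<and> B \<circ> B = A)"

definition AT :: "('a::chilbert \<Rightarrow> 'a) \<Rightarrow> ('a \<Rightarrow> 'a)" where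
  "AT T x = lim (\<lambda>n. (cadj T ^^ n) ((T ^^ n) x))"

definition H0 :: "('a::chilbert \<Rightarrow> 'a) \<Rightarrow> 'a set" where
  "H0 T = {x. (\<lambda>n. (T ^^ n) x) \<longlonglongrightarrow> 0}"

text \<open>Operators on a closed subspace M are represented as functions on the whole space
  mapping M into M and vanishing off M.  \<open>T_00 = P_0 T | H_0\<close>.\<close>
definition T00 :: "('a::chilbert \<Rightarrow> 'a) \<Rightarrow> ('a \<Rightarrow> 'a)" where
  "T00 T x = (if x \<in> H0 T then cproj (H0 T) (T x) else 0)"

definition sub_adj :: "'a::chilbert set \<Rightarrow> ('a \<Rightarrow> 'a) \<Rightarrow> ('a \<Rightarrow> 'a)" where
  "sub_adj M S = (THE S'. (\<forall>x. x \<notin> M \<longrightarrow> S' x = 0) \<and> (\<forall>x\<in>M. S' x \<in> M)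
       \<and> (\<forall>x\<in>M. \<forall>y\<in>M. cinner (S x) y = cinner x (S' y)))"

definition psp_on :: "'a::chilbert set \<Rightarrow> ('a \<Rightarrow> 'a) \<Rightarrow> complex set" where
  "psp_on M S = {l. \<exists>x\<in>M. x \<noteq> 0 \<and> S x = scaleC l x}"

abbreviation psp :: "('a::chilbert \<Rightarrow> 'a) \<Rightarrow> complex set" where
  "psp S \<equiv> psp_on UNIV S"

definition root_subspace :: "'a::chilbert set \<Rightarrow> ('a \<Rightarrow> 'a) \<Rightarrow> complex \<Rightarrow> 'a set" where
  "root_subspace M S l = clspan (\<Union>j\<in>{1..}. {x\<in>M. ((\<lambda>y. S y - scaleC l y) ^^ j) x = 0})"

definition gen_root_system :: "'a::chilbert set \<Rightarrow> ('a \<Rightarrow> 'a) \<Rightarrow> bool" where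
  "gen_root_system M S \<longleftrightarrow> clspan (\<Union>l\<in>psp_on M S. root_subspace M S l) = M"

definition RT :: "('a::chilbert \<Rightarrow> 'a) \<Rightarrow> 'a set" where
  "RT T = closure (range (AT T))"

definition VT :: "('a::chilbert \<Rightarrow> 'a) \<Rightarrow> ('a \<Rightarrow> 'a)" where
  "VT T = (THE V. (\<forall>x. x \<notin> RT T \<longrightarrow> V x = 0) \<and> (\<forall>x\<in>RT T. V x \<in> RT T)
      \<and> (\<forall>x\<in>RT T. \<forall>y\<in>RT T. V (x + y) = V x + V y)
      \<and> (\<forall>c. \<forall>x\<in>RT T. V (scaleC c x) = scaleC c (V x))
      \<and> (\<forall>x\<in>RT T. norm (V x) = norm x)
      \<and> (\<forall>x. csqrt_op (AT T) (T x) = V (csqrt_op (AT T) x)))"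

text \<open>\<open>W\<close> on \<open>K\<close> (with \<open>R\<close> embedded in \<open>K\<close> by the linear isometry \<open>J\<close>) is a minimal unitary
  dilation of the isometry V acting on the closed subspace R.\<close>
definition unitary_op :: "('b::chilbert \<Rightarrow> 'b) \<Rightarrow> bool" where
  "unitary_op W \<longleftrightarrow> cblinop W \<and> (\<forall>x. norm (W x) = norm x) \<and> surj W"

definition min_unitary_dilation ::
    "'a::chilbert set \<Rightarrow> ('a \<Rightarrow> 'a) \<Rightarrow> ('a \<Rightarrow> 'b::chilbert) \<Rightarrow> ('b \<Rightarrow> 'b) \<Rightarrow> bool" where
  "min_unitary_dilation R V J W \<longleftrightarrow>
     (\<forall>x\<in>R. \<forall>y\<in>R. J (x + y) = J x + J y)
   \<and> (\<forall>c. \<forall>x\<in>R. J (scaleC c x) = scaleC c (J x))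
   \<and> (\<forall>x\<in>R. norm (J x) = norm x)
   \<and> unitary_op W
   \<and> (\<forall>n. \<forall>x\<in>R. \<forall>y\<in>R. cinner (J y) ((W ^^ n) (J x)) = cinner y ((V ^^ n) x))
   \<and> clspan (\<Union>n. (W ^^ n) ` J ` R \<union> (cadj W ^^ n) ` J ` R) = UNIV"

definition commutant :: "('a::chilbert \<Rightarrow> 'a) \<Rightarrow> ('a \<Rightarrow> 'a) set" where
  "commutant T = {C. cblinop C \<and> C \<circ> T = T \<circ> C}"

definition XT :: "('a::chilbert \<Rightarrow> 'a) \<Rightarrow> ('a \<Rightarrow> 'b::chilbert) \<Rightarrow> ('a \<Rightarrow> 'b)" where
  "XT T J x = J (csqrt_op (AT T) x)"

definition gammaT :: "('a::chilbert \<Rightarrow> 'a) \<Rightarrow> ('a \<Rightarrow> 'b::chilbert) \<Rightarrow> ('b \<Rightarrow> 'b)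
     \<Rightarrow> ('a \<Rightarrow> 'a) \<Rightarrow> ('b \<Rightarrow> 'b)" where
  "gammaT T J W C = (THE D. D \<in> commutant W \<and> (\<forall>x. XT T J (C x) = D (XT T J x)))"

end

theory Submission
  imports Defs
begin

text \<open>
  Write \<open>X\<close> for \<open>X\<^sub>T\<close>. The kernel of \<open>\<gamma>\<^sub>T\<close> consists of the \<open>C\<close> commuting with \<open>T\<close> such that \<open>X C = 0\<close>, that
  is, of those with range in \<open>H\<^sub>0\<close>. A common eigenvalue \<open>T x = \<lambda> x\<close>, \<open>T\<^sup>* y = \<lambda>\<^sup>* y\<close> with
  \<open>\<bar>\<lambda>\<bar> < 1\<close> gives the rank one kernel element \<open>z \<mapsto> \<langle>y, z\<rangle> x\<close>. Conversely, if \<open>C \<noteq> 0\<close> has range in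
  \<open>H\<^sub>0\<close>, then \<open>C\<^sup>*\<close> restricted to \<open>H\<^sub>0\<close> is nonzero and intertwines \<open>T\<^sub>0\<^sub>0\<^sup>*\<close> with \<open>T\<^sup>*\<close>. As the root
  vectors of \<open>T\<^sub>0\<^sub>0\<^sup>*\<close> span \<open>H\<^sub>0\<close>, one of them is not annihilated by \<open>C\<^sup>*\<close>; its image is a root vector
  of \<open>T\<^sup>*\<close> for the same eigenvalue, and the spectral assumption together with stability places the
  conjugate eigenvalue in the point spectrum of \<open>T\<close> and in the disc.

  For \<open>\<gamma>\<^sub>T\<close> to be well defined, the asymptotic limit \<open>A\<^sub>T\<close>, its unique positive square root, the
  isometry \<open>V\<^sub>T\<close> and the lift of a commutant element to \<open>{W}'\<close> must exist. The lift maps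
  \<open>W\<^sup>-\<^sup>n X x\<close> to \<open>W\<^sup>-\<^sup>n X C x\<close>; such vectors are dense by minimality, and \<open>\<parallel>X C x\<parallel> \<le> \<parallel>C\<parallel> \<parallel>X x\<parallel>\<close>
  because \<open>\<parallel>X x\<parallel> = lim \<parallel>T\<^sup>n x\<parallel>\<close>.
\<close>

section \<open>Complex Hilbert spaces\<close>

lemma scaleC_zero_left [simp]: "scaleC 0 (x::'a::chilbert) = 0"
  using scaleC_add_left[of 0 0 x] by simp

lemma scaleC_zero_right [simp]: "scaleC a (0::'a::chilbert) = 0"
  using scaleC_add_right[of a 0 0] by simp

lemma scaleC_minus_right: "scaleC a (- x) = - scaleC a (x::'a::chilbert)"
  using scaleC_add_right[of a x "- x"] by (simp add: eq_neg_iff_add_eq_0 add.commute)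

lemma scaleC_diff_right: "scaleC a (x - y) = scaleC a x - scaleC a (y::'a::chilbert)"
  using scaleC_add_right[of a x "- y"] by (simp add: scaleC_minus_right)

lemma scaleC_minus_one: "scaleC (- 1) x = - (x::'a::chilbert)"
  using scaleR_scaleC[of "- 1" x] by simp

lemma cinner_add_right: "cinner x (y + z) = cinner x y + cinner x (z::'a::chilbert)"
  by (metis cinner_add_left cinner_commute complex_cnj_add)

lemma cinner_scaleC_right: "cinner x (scaleC a y) = a * cinner x (y::'a::chilbert)"
  by (metis cinner_commute cinner_scaleC_left complex_cnj_cnj complex_cnj_mult)

lemma cinner_zero_left [simp]: "cinner 0 (y::'a::chilbert) = 0"
  using cinner_scaleC_left[of 0 0 y] by simp

lemma cinner_zero_right [simp]: "cinner (y::'a::chilbert) 0 = 0"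
  using cinner_scaleC_right[of y 0 0] by simp

lemma cinner_minus_left: "cinner (- x) y = - cinner x (y::'a::chilbert)"
  using cinner_scaleC_left[of "- 1" x y] by (simp add: scaleC_minus_one)

lemma cinner_minus_right: "cinner x (- y) = - cinner x (y::'a::chilbert)"
  using cinner_scaleC_right[of x "- 1" y] by (simp add: scaleC_minus_one)

lemma cinner_diff_left: "cinner (x - y) z = cinner x z - cinner y (z::'a::chilbert)"
  using cinner_add_left[of x "- y" z] by (simp add: cinner_minus_left)

lemma cinner_diff_right: "cinner x (y - z) = cinner x y - cinner x (z::'a::chilbert)"
  using cinner_add_right[of x y "- z"] by (simp add: cinner_minus_right)

lemma cinner_scaleR_left: "cinner (r *\<^sub>R x) y = complex_of_real r * cinner x (y::'a::chilbert)"
  by (simp add: scaleR_scaleC cinner_scaleC_left)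

lemma cinner_scaleR_right: "cinner x (r *\<^sub>R y) = complex_of_real r * cinner x (y::'a::chilbert)"
  by (simp add: scaleR_scaleC cinner_scaleC_right)

lemmas cinner_simps =
  cinner_add_left cinner_add_right cinner_diff_left cinner_diff_right
  cinner_scaleC_left cinner_scaleC_right cinner_scaleR_left cinner_scaleR_right
  cinner_minus_left cinner_minus_right

lemma Re_cinner_self: "Re (cinner x x) = (norm (x::'a::chilbert))\<^sup>2"
proof -
  have "0 \<le> sqrt (Re (cinner x x))"
    using norm_cinner[of x] norm_ge_zero[of x] by simp
  then show ?thesis
    by (simp add: norm_cinner)
qed

lemma cinner_self: "cinner x x = complex_of_real ((norm (x::'a::chilbert))\<^sup>2)"
proof -
  have "Im (cinner x x) = 0"
    using cinner_commute[of x x] by (metis Reals_cnj_iff complex_is_Real_iff)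
  then show ?thesis
    by (simp add: complex_eq_iff Re_cinner_self)
qed

lemma cinner_self_eq_0 [simp]: "cinner x x = 0 \<longleftrightarrow> (x::'a::chilbert) = 0"
  by (simp add: cinner_self)

lemma Re_cinner_commute: "Re (cinner x y) = Re (cinner y (x::'a::chilbert))"
  by (subst cinner_commute) simp

lemma norm_scaleC: "norm (scaleC c x) = norm c * norm (x::'a::chilbert)"
proof -
  have "(norm (scaleC c x))\<^sup>2 = (norm c * norm x)\<^sup>2"
  proof -
    have "cinner (scaleC c x) (scaleC c x) = (c * cnj c) * cinner x x"
      by (simp add: cinner_simps)
    also have "\<dots> = complex_of_real ((norm c)\<^sup>2 * (norm x)\<^sup>2)"
      by (simp only: complex_norm_square[symmetric] cinner_self of_real_mult)
    finally show ?thesis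
      by (metis Re_cinner_self Re_complex_of_real power_mult_distrib)
  qed
  then show ?thesis
    by simp
qed

lemma norm_add_square:
  "(norm (x + y))\<^sup>2 = (norm x)\<^sup>2 + 2 * Re (cinner x y) + (norm (y::'a::chilbert))\<^sup>2"
  by (simp add: Re_cinner_self[symmetric] cinner_simps Re_cinner_commute[of y x])

lemma norm_diff_square:
  "(norm (x - y))\<^sup>2 = (norm x)\<^sup>2 - 2 * Re (cinner x y) + (norm (y::'a::chilbert))\<^sup>2"
  by (simp add: Re_cinner_self[symmetric] cinner_simps Re_cinner_commute[of y x])

lemma parallelogram_law:
  "(norm (x + y))\<^sup>2 + (norm (x - y))\<^sup>2 = 2 * (norm x)\<^sup>2 + 2 * (norm (y::'a::chilbert))\<^sup>2"
  by (simp add: norm_add_square norm_diff_square)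

lemma Re_cinner_le: "Re (cinner x y) \<le> norm x * norm (y::'a::chilbert)"
proof -
  have "(norm (x + y))\<^sup>2 \<le> (norm x + norm y)\<^sup>2"
    by (intro power_mono norm_triangle_ineq) auto
  then show ?thesis
    by (simp add: norm_add_square power2_sum)
qed

lemma norm_cinner_le: "norm (cinner x y) \<le> norm x * norm (y::'a::chilbert)"
proof -
  define c where "c = cnj (sgn (cinner x y))"
  have "complex_of_real (norm (cinner x y)) = cinner x (scaleC c y)"
  proof (cases "cinner x y = 0")
    case False
    then show ?thesis
      by (simp add: c_def cinner_simps sgn_eq complex_norm_square[symmetric] power2_eq_square
          divide_simps mult.commute flip: of_real_mult)
  qed (simp add: cinner_simps)
  then have "norm (cinner x y) = Re (cinner x (scaleC c y))"
    by (metis Re_complex_of_real)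
  also have "\<dots> \<le> norm x * (norm c * norm y)"
    using Re_cinner_le[of x "scaleC c y"] by (simp add: norm_scaleC)
  also have "\<dots> \<le> norm x * (1 * norm y)"
    by (intro mult_left_mono mult_right_mono) (auto simp: c_def norm_sgn)
  finally show ?thesis
    by simp
qed

lemma bounded_bilinear_cinner: "bounded_bilinear (cinner :: 'a::chilbert \<Rightarrow> 'a \<Rightarrow> complex)"
proof
  show "\<exists>K. \<forall>a b::'a. norm (cinner a b) \<le> norm a * norm b * K"
    by (rule exI[of _ 1]) (simp add: norm_cinner_le)
qed (auto simp: cinner_simps scaleR_conv_of_real)

lemmas tendsto_cinner = bounded_bilinear.tendsto[OF bounded_bilinear_cinner]

lemma bounded_linear_scaleC: "bounded_linear (scaleC c :: 'a::chilbert \<Rightarrow> 'a)"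
  by (rule bounded_linear_intro[where K = "norm c"])
    (auto simp: scaleC_add_right scaleR_scaleC scaleC_scaleC norm_scaleC mult.commute)

lemmas tendsto_scaleC = bounded_linear.tendsto[OF bounded_linear_scaleC]

lemma cinner_ext_right: "(\<And>z. cinner z x = cinner z y) \<Longrightarrow> x = (y::'a::chilbert)"
  using cinner_self_eq_0[of "x - y"] by (simp add: cinner_diff_right)

instance chilbert \<subseteq> banach ..

instantiation prod :: (chilbert, chilbert) chilbert
begin

definition scaleC_prod :: "complex \<Rightarrow> 'a \<times> 'b \<Rightarrow> 'a \<times> 'b" where
  "scaleC_prod c p = (scaleC c (fst p), scaleC c (snd p))"

definition cinner_prod :: "'a \<times> 'b \<Rightarrow> 'a \<times> 'b \<Rightarrow> complex" where
  "cinner_prod p q = cinner (fst p) (fst q) + cinner (snd p) (snd q)"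

instance
proof
  fix p q r :: "'a \<times> 'b" and a b :: complex and t :: real
  show "scaleC a (p + q) = scaleC a p + scaleC a q" "scaleC (a + b) p = scaleC a p + scaleC b p"
    "scaleC a (scaleC b p) = scaleC (a * b) p" "scaleC 1 p = p" "t *\<^sub>R p = scaleC (complex_of_real t) p"
    by (simp_all add: scaleC_prod_def scaleC_add_right scaleC_add_left scaleC_scaleC scaleC_one
        scaleR_prod_def scaleR_scaleC)
  show "cinner (p + q) r = cinner p r + cinner q r" "cinner (scaleC a p) q = cnj a * cinner p q"
    by (simp_all add: cinner_prod_def scaleC_prod_def cinner_simps distrib_left)
  show "cinner p q = cnj (cinner q p)"
    by (simp add: cinner_prod_def flip: cinner_commute)
  show "norm p = sqrt (Re (cinner p p))"
    by (simp add: norm_prod_def cinner_prod_def Re_cinner_self)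
qed

end

lemma scaleC_Pair [simp]: "scaleC c (a, b) = (scaleC c a, scaleC c b)"
  by (simp add: scaleC_prod_def)

lemma Cauchy_if_dist_square_le:
  fixes f :: "nat \<Rightarrow> 'a::metric_space"
  assumes le: "\<And>m n. (dist (f m) (f n))\<^sup>2 \<le> e m + e n" and "e \<longlonglongrightarrow> 0"
  shows "Cauchy f"
proof (rule metric_CauchyI)
  fix \<epsilon> :: real assume "\<epsilon> > 0"
  then have "eventually (\<lambda>n. e n < \<epsilon>\<^sup>2 / 2) sequentially"
    by (intro order_tendstoD[OF \<open>e \<longlonglongrightarrow> 0\<close>]) simp
  then obtain N where N: "\<And>n. n \<ge> N \<Longrightarrow> e n < \<epsilon>\<^sup>2 / 2"
    unfolding eventually_sequentially by blast
  have "dist (f m) (f n) < \<epsilon>" if "m \<ge> N" "n \<ge> N" for m n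
  proof (rule power2_less_imp_less)
    show "(dist (f m) (f n))\<^sup>2 < \<epsilon>\<^sup>2"
      using le[of m n] N[OF that(1)] N[OF that(2)] by simp
  qed (use \<open>\<epsilon> > 0\<close> in simp)
  then show "\<exists>N. \<forall>m\<ge>N. \<forall>n\<ge>N. dist (f m) (f n) < \<epsilon>"
    by blast
qed

lemma eq_if_norm_le_Re_cinner_eq:
  assumes "norm x \<le> norm y" "Re (cinner x y) = (norm y)\<^sup>2"
  shows "x = (y::'a::chilbert)"
proof -
  have "(norm x)\<^sup>2 \<le> (norm y)\<^sup>2"
    using assms(1) by (simp add: power_mono)
  then have "(norm (x - y))\<^sup>2 \<le> 0"
    using assms(2) by (simp add: norm_diff_square)
  then show ?thesis
    by simp
qed

section \<open>Closed subspaces and orthogonal projections\<close>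

definition csubspace :: "'a::chilbert set \<Rightarrow> bool" where
  "csubspace M \<longleftrightarrow> 0 \<in> M \<and> (\<forall>x\<in>M. \<forall>y\<in>M. x + y \<in> M) \<and> (\<forall>c. \<forall>x\<in>M. scaleC c x \<in> M)"

lemma csubspace_0: "csubspace M \<Longrightarrow> 0 \<in> M"
  and csubspace_add: "csubspace M \<Longrightarrow> x \<in> M \<Longrightarrow> y \<in> M \<Longrightarrow> x + y \<in> M"
  and csubspace_scaleC: "csubspace M \<Longrightarrow> x \<in> M \<Longrightarrow> scaleC c x \<in> M"
  by (auto simp: csubspace_def)

lemma csubspace_imp_subspace: "csubspace M \<Longrightarrow> subspace M"
  by (auto simp: csubspace_def subspace_def scaleR_scaleC)

lemma csubspace_diff: "csubspace M \<Longrightarrow> x \<in> M \<Longrightarrow> y \<in> M \<Longrightarrow> x - y \<in> M"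
  by (intro subspace_diff csubspace_imp_subspace)

lemma csubspace_UNIV: "csubspace UNIV"
  by (simp add: csubspace_def)

lemma csubspace_closure:
  assumes "csubspace M"
  shows "csubspace (closure M)"
  unfolding csubspace_def
proof (intro conjI ballI allI)
  show "0 \<in> closure M"
    using assms closure_subset csubspace_0 by blast
next
  fix x y assume "x \<in> closure M" "y \<in> closure M"
  then obtain f g where "\<forall>n. f n \<in> M" "f \<longlonglongrightarrow> x" "\<forall>n. g n \<in> M" "g \<longlonglongrightarrow> y"
    unfolding closure_sequential by blast
  then show "x + y \<in> closure M"
    unfolding closure_sequential using assms
    by (intro exI[of _ "\<lambda>n. f n + g n"]) (auto intro: tendsto_add csubspace_add)
next
  fix c x assume "x \<in> closure M"
  then have "scaleC c x \<in> closure (scaleC c ` M)"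
    using closure_bounded_linear_image_subset[OF bounded_linear_scaleC] by blast
  then show "scaleC c x \<in> closure M"
    using closure_mono[of "scaleC c ` M" M] csubspace_scaleC[OF assms] by blast
qed

lemma csubspace_incseq_Union:
  assumes "incseq M" "\<And>n::nat. csubspace (M n)"
  shows "csubspace (\<Union>n. M n)"
  unfolding csubspace_def
proof (intro conjI ballI allI)
  show "0 \<in> (\<Union>n. M n)"
    using csubspace_0[OF assms(2)] by blast
next
  fix x y assume "x \<in> (\<Union>n. M n)" "y \<in> (\<Union>n. M n)"
  then obtain m n where "x \<in> M m" "y \<in> M n"
    by blast
  then have "x \<in> M (max m n)" "y \<in> M (max m n)"
    using incseqD[OF assms(1)] by (meson max.cobounded1 max.cobounded2 subsetD)+
  then show "x + y \<in> (\<Union>n. M n)"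
    using csubspace_add[OF assms(2)] by blast
qed (use csubspace_scaleC[OF assms(2)] in blast)

lemma clspan_minimal:
  assumes "A \<subseteq> M" "csubspace M" "closed M"
  shows "clspan A \<subseteq> M"
proof -
  have "cspan A \<subseteq> M"
    using assms
    by (auto simp: cspan_def intro!: subspace_sum[OF csubspace_imp_subspace] csubspace_scaleC)
  then show ?thesis
    unfolding clspan_def using assms(3) by (simp add: closure_minimal)
qed

lemma apollonius:
  "(dist u v)\<^sup>2 = 2 * (dist x u)\<^sup>2 + 2 * (dist x v)\<^sup>2 - 4 * (dist x (midpoint u (v::'a::chilbert)))\<^sup>2"
proof -
  have "2 *\<^sub>R (x - midpoint u v) = (x - u) + (x - v)"
    by (simp add: midpoint_def scaleR_diff_right scaleR_2)
  then have "4 * (dist x (midpoint u v))\<^sup>2 = (norm ((x - u) + (x - v)))\<^sup>2"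
    by (metis dist_norm norm_scaleR abs_numeral power_mult_distrib four_x_squared)
  then show ?thesis
    using parallelogram_law[of "x - u" "x - v"] by (simp add: dist_norm norm_minus_commute)
qed

lemma minimizing_sequence_Cauchy:
  fixes x :: "'a::chilbert"
  assumes "convex M" and y: "\<And>n::nat. y n \<in> M" and lim: "(\<lambda>n. dist x (y n)) \<longlonglongrightarrow> infdist x M"
  shows "Cauchy y"
proof (rule Cauchy_if_dist_square_le)
  let ?e = "\<lambda>n. 2 * ((dist x (y n))\<^sup>2 - (infdist x M)\<^sup>2)"
  have "midpoint (y m) (y n) \<in> M" for m n
    using convexD[OF \<open>convex M\<close> y y, of "1/2" "1/2"] by (simp add: midpoint_def scaleR_add_right)
  then have "(infdist x M)\<^sup>2 \<le> (dist x (midpoint (y m) (y n)))\<^sup>2" for m n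
    by (intro power_mono infdist_le infdist_nonneg)
  then show "(dist (y m) (y n))\<^sup>2 \<le> ?e m + ?e n" for m n
    unfolding apollonius[of "y m" "y n" x] by (simp add: algebra_simps)
  have "?e \<longlonglongrightarrow> 2 * ((infdist x M)\<^sup>2 - (infdist x M)\<^sup>2)"
    by (intro tendsto_intros lim)
  then show "?e \<longlonglongrightarrow> 0"
    by simp
qed

lemma nearest_point_exists:
  fixes x :: "'a::chilbert"
  assumes "convex M" "closed M" "M \<noteq> {}"
  shows "\<exists>y\<in>M. dist x y = infdist x M"
proof -
  have "\<exists>y\<in>M. dist x y < infdist x M + inverse (real (Suc n))" for n
  proof -
    have "(INF y\<in>M. dist x y) < infdist x M + inverse (real (Suc n))"
      unfolding infdist_notempty[OF \<open>M \<noteq> {}\<close>] by simp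
    then show ?thesis
      using \<open>M \<noteq> {}\<close> by (subst (asm) cINF_less_iff) auto
  qed
  then obtain y where y: "\<And>n. y n \<in> M" and le: "\<And>n. dist x (y n) < infdist x M + inverse (real (Suc n))"
    by metis
  have "(\<lambda>n. dist x (y n)) \<longlonglongrightarrow> infdist x M"
  proof (rule tendsto_sandwich[OF _ _ tendsto_const])
    show "(\<lambda>n. infdist x M + inverse (real (Suc n))) \<longlonglongrightarrow> infdist x M"
      by (rule LIMSEQ_inverse_real_of_nat_add)
  qed (use infdist_le[OF y] less_imp_le[OF le] in \<open>simp_all del: of_nat_Suc\<close>)
  moreover obtain l where l: "y \<longlonglongrightarrow> l"
    using minimizing_sequence_Cauchy[OF \<open>convex M\<close> y calculation] Cauchy_convergent
    unfolding convergent_def by blast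
  ultimately have "dist x l = infdist x M"
    using LIMSEQ_unique tendsto_dist[OF tendsto_const l] by blast
  then show ?thesis
    using closed_sequentially[OF \<open>closed M\<close> _ l] y by blast
qed

lemma nonneg_quadratic_imp_discriminant:
  fixes a b c :: real
  assumes nonneg: "\<And>t. 0 \<le> a + 2 * t * b + t\<^sup>2 * c"
  shows "b\<^sup>2 \<le> a * c"
proof -
  consider "c > 0" | "c = 0" | "c < 0"
    by linarith
  then show ?thesis
  proof cases
    assume "c > 0"
    then show ?thesis
      using nonneg[of "- b / c"] by (simp add: field_simps power2_eq_square)
  next
    assume "c = 0"
    then have "b = 0"
      using nonneg[of "- (a + 1) / (2 * b)"] by (cases "b = 0") (auto simp: field_simps)
    then show ?thesis
      using \<open>c = 0\<close> by simp
  next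
    assume "c < 0"
    define t where "t = sqrt ((a + 1) / - c)"
    have "a \<ge> 0"
      using nonneg[of 0] by simp
    then have "t\<^sup>2 = (a + 1) / - c"
      using \<open>c < 0\<close> unfolding t_def by (intro real_sqrt_pow2 divide_nonneg_pos) auto
    then have "t\<^sup>2 * c = - (a + 1)"
      using \<open>c < 0\<close> by simp
    then show ?thesis
      using nonneg[of t] nonneg[of "- t"] by simp
  qed
qed

lemma nearest_point_orthogonal:
  fixes x :: "'a::chilbert"
  assumes M: "csubspace M" and y: "y \<in> M" "dist x y = infdist x M" and z: "z \<in> M"
  shows "cinner z (x - y) = 0"
proof -
  have Re_orthogonal: "Re (cinner w (x - y)) = 0" if w: "w \<in> M" for w
  proof -
    have "0 \<le> 0 + 2 * t * Re (cinner w (x - y)) + t\<^sup>2 * (norm w)\<^sup>2" for t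
    proof -
      have "y - t *\<^sub>R w \<in> M"
        using M y w by (auto simp: scaleR_scaleC intro: csubspace_diff csubspace_scaleC)
      then have "norm (x - y) \<le> norm ((x - y) + t *\<^sub>R w)"
        using infdist_le[of "y - t *\<^sub>R w" M x] y(2) by (simp add: dist_norm algebra_simps)
      then have "(norm (x - y))\<^sup>2 \<le> (norm ((x - y) + t *\<^sub>R w))\<^sup>2"
        by (intro power_mono) simp_all
      then show ?thesis
        unfolding norm_add_square Re_cinner_commute[of "x - y"]
        by (simp add: cinner_scaleR_left power_mult_distrib mult.assoc)
    qed
    then show ?thesis
      using nonneg_quadratic_imp_discriminant by fastforce
  qed
  then show ?thesis
    using Re_orthogonal[OF z] Re_orthogonal[OF csubspace_scaleC[OF M z, of \<i>]]
    by (simp add: cinner_scaleC_left complex_eq_iff)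
qed

lemma cproj_eqI:
  assumes M: "csubspace M" and y: "y \<in> M" "\<And>z. z \<in> M \<Longrightarrow> cinner z (x - y) = 0"
  shows "cproj M x = y"
  unfolding cproj_def
proof (rule the_equality)
  fix w assume w: "w \<in> M \<and> (\<forall>z\<in>M. cinner z (x - w) = 0)"
  then have "w - y \<in> M"
    using M y(1) by (blast intro: csubspace_diff)
  then have "cinner (w - y) (x - y) = 0" "cinner (w - y) (x - w) = 0"
    using w y(2) by blast+
  then have "cinner (w - y) (w - y) = 0"
    by (simp add: cinner_diff_right)
  then show "w = y"
    by simp
qed (use y in blast)

lemma
  assumes M: "csubspace M" "closed M"
  shows cproj_in: "cproj M x \<in> M" and cproj_orthogonal: "z \<in> M \<Longrightarrow> cinner z (x - cproj M x) = 0"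
proof -
  obtain y where y: "y \<in> M" "dist x y = infdist x M"
    using nearest_point_exists[of M x] subspace_imp_convex[OF csubspace_imp_subspace[OF M(1)]]
      M(2) csubspace_0[OF M(1)] by blast
  then have "cproj M x = y"
    using cproj_eqI[OF M(1)] nearest_point_orthogonal[OF M(1)] by blast
  then show "cproj M x \<in> M" "z \<in> M \<Longrightarrow> cinner z (x - cproj M x) = 0"
    using y nearest_point_orthogonal[OF M(1)] by blast+
qed

lemma cproj_ident: "csubspace M \<Longrightarrow> x \<in> M \<Longrightarrow> cproj M x = x"
  by (rule cproj_eqI) simp_all

section \<open>Bounded operators and isometries\<close>

definition clinear_on :: "'a::chilbert set \<Rightarrow> ('a \<Rightarrow> 'b::chilbert) \<Rightarrow> bool" where
  "clinear_on M f \<longleftrightarrow> (\<forall>x\<in>M. \<forall>y\<in>M. f (x + y) = f x + f y)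
     \<and> (\<forall>c. \<forall>x\<in>M. f (scaleC c x) = scaleC c (f x))"

lemma clinear_on_add: "clinear_on M f \<Longrightarrow> x \<in> M \<Longrightarrow> y \<in> M \<Longrightarrow> f (x + y) = f x + f y"
  and clinear_on_scaleC: "clinear_on M f \<Longrightarrow> x \<in> M \<Longrightarrow> f (scaleC c x) = scaleC c (f x)"
  by (auto simp: clinear_on_def)

lemma clinear_on_diff:
  assumes "clinear_on M f" "csubspace M" "x \<in> M" "y \<in> M"
  shows "f (x - y) = f x - f y"
  using clinear_on_add[OF assms(1,3), of "scaleC (- 1) y"] clinear_on_scaleC[OF assms(1,4), of "- 1"]
    csubspace_scaleC[OF assms(2,4), of "- 1"]
  by (simp add: scaleC_minus_one)

lemma clinear_on_bounded_imp_lipschitz: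
  assumes f: "clinear_on M f" and M: "csubspace M"
    and bound: "\<And>x. x \<in> M \<Longrightarrow> norm (f x) \<le> K * norm x" and "K \<ge> 0"
  shows "K-lipschitz_on M f"
proof (rule lipschitz_onI)
  fix x y assume xy: "x \<in> M" "y \<in> M"
  then show "dist (f x) (f y) \<le> K * dist x y"
    using bound[OF csubspace_diff[OF M xy]] by (simp add: dist_norm clinear_on_diff[OF f M])
qed fact

lemma clinear_on_closure:
  assumes f: "clinear_on M f" and M: "csubspace M" and cont: "continuous_on (closure M) f"
  shows "clinear_on (closure M) f"
  unfolding clinear_on_def
proof (intro conjI ballI allI)
  have lim: "(\<lambda>n. f (u n)) \<longlonglongrightarrow> f x" if "\<And>n. u n \<in> M" "u \<longlonglongrightarrow> x" for u x
    using cont that closure_sequential[of x M]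
    unfolding continuous_on_closure_sequentially comp_def by blast
  fix x assume "x \<in> closure M"
  then obtain u where u: "\<And>n. u n \<in> M" "u \<longlonglongrightarrow> x"
    unfolding closure_sequential by blast
  have "(\<lambda>n. scaleC c (f (u n))) \<longlonglongrightarrow> f (scaleC c x)" for c
    using lim[OF csubspace_scaleC[OF M u(1)] tendsto_scaleC[OF u(2)]]
    by (simp add: clinear_on_scaleC[OF f u(1)])
  then show "f (scaleC c x) = scaleC c (f x)" for c
    using tendsto_scaleC[OF lim[OF u]] LIMSEQ_unique by blast
  fix y assume "y \<in> closure M"
  then obtain v where v: "\<And>n. v n \<in> M" "v \<longlonglongrightarrow> y"
    unfolding closure_sequential by blast
  have "(\<lambda>n. f (u n) + f (v n)) \<longlonglongrightarrow> f (x + y)"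
    using lim[OF csubspace_add[OF M u(1) v(1)] tendsto_add[OF u(2) v(2)]]
    by (simp add: clinear_on_add[OF f u(1) v(1)])
  then show "f (x + y) = f x + f y"
    using tendsto_add[OF lim[OF u] lim[OF v]] LIMSEQ_unique by blast
qed

lemma continuous_on_closure_eqI:
  fixes f g :: "'a::topological_space \<Rightarrow> 'b::real_normed_vector"
  assumes "continuous_on (closure A) f" "continuous_on (closure A) g"
    and "\<And>x. x \<in> A \<Longrightarrow> f x = g x" and "x \<in> closure A"
  shows "f x = g x"
  using continuous_constant_on_closure[of A "\<lambda>x. f x - g x" 0 x] assms
  by (simp add: continuous_on_diff)

definition cisometry_on :: "'a::chilbert set \<Rightarrow> ('a \<Rightarrow> 'b::chilbert) \<Rightarrow> bool" where
  "cisometry_on M f \<longleftrightarrow> clinear_on M f \<and> (\<forall>x\<in>M. norm (f x) = norm x)"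

lemma cisometry_on_clinear_on: "cisometry_on M f \<Longrightarrow> clinear_on M f"
  and cisometry_on_norm: "cisometry_on M f \<Longrightarrow> x \<in> M \<Longrightarrow> norm (f x) = norm x"
  by (auto simp: cisometry_on_def)

lemma cisometry_on_continuous_on: "cisometry_on M f \<Longrightarrow> csubspace M \<Longrightarrow> continuous_on M f"
  using clinear_on_bounded_imp_lipschitz[of M f 1]
  by (intro lipschitz_on_continuous_on[of 1]) (simp add: cisometry_on_def)

lemma cblinop_add: "cblinop T \<Longrightarrow> T (x + y) = T x + T y"
  and cblinop_scaleC: "cblinop T \<Longrightarrow> T (scaleC c x) = scaleC c (T x)"
  by (auto simp: cblinop_def)

lemma cblinopI:
  "(\<And>x y. T (x + y) = T x + T y) \<Longrightarrow> (\<And>c x. T (scaleC c x) = scaleC c (T x)) \<Longrightarrow>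
    (\<And>x. norm (T x) \<le> K * norm x) \<Longrightarrow> cblinop T"
  by (auto simp: cblinop_def)

lemma cblinop_bounded_linear:
  assumes "cblinop T"
  shows "bounded_linear T"
proof -
  obtain K where "\<And>x. norm (T x) \<le> K * norm x"
    using assms by (auto simp: cblinop_def)
  then show ?thesis
    using assms by (intro bounded_linear_intro[where K = K])
      (auto simp: cblinop_add scaleR_scaleC cblinop_scaleC mult.commute)
qed

lemma bounded_linear_cblinop:
  assumes "bounded_linear T" "\<And>c x. T (scaleC c x) = scaleC c (T x)"
  shows "cblinop T"
  using bounded_linear.bounded[OF assms(1)] assms
  by (auto simp: cblinop_def linear_simps mult.commute)

lemma cblinop_0: "cblinop T \<Longrightarrow> T 0 = 0"
  and cblinop_diff: "cblinop T \<Longrightarrow> T (x - y) = T x - T y"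
  and cblinop_scaleR: "cblinop T \<Longrightarrow> T (r *\<^sub>R x) = r *\<^sub>R T x"
  and cblinop_tendsto: "cblinop T \<Longrightarrow> (f \<longlongrightarrow> l) F \<Longrightarrow> ((\<lambda>n. T (f n)) \<longlongrightarrow> T l) F"
  and cblinop_continuous_on: "cblinop T \<Longrightarrow> continuous_on A T"
  by (auto dest!: cblinop_bounded_linear
      simp: linear_simps bounded_linear.tendsto linear_continuous_on)

lemma cblinop_pos_bound:
  assumes "cblinop T"
  obtains K where "K > 0" "\<And>x. norm (T x) \<le> K * norm x"
  using bounded_linear.pos_bounded[OF cblinop_bounded_linear[OF assms]]
  by (auto simp: mult.commute)

lemma cblinop_id: "cblinop (\<lambda>x. x)"
  by (rule cblinopI[where K = 1]) auto

lemma cblinop_zero: "cblinop (\<lambda>x. 0)"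
  by (rule cblinopI[where K = 0]) auto

lemma cblinop_compose: "cblinop S \<Longrightarrow> cblinop T \<Longrightarrow> cblinop (\<lambda>x. S (T x))"
  by (rule bounded_linear_cblinop)
    (auto intro: bounded_linear_compose cblinop_bounded_linear simp: cblinop_scaleC)

lemma cblinop_plus: "cblinop S \<Longrightarrow> cblinop T \<Longrightarrow> cblinop (\<lambda>x. S x + T x)"
  by (rule bounded_linear_cblinop)
    (auto intro: bounded_linear_add cblinop_bounded_linear simp: cblinop_scaleC scaleC_add_right)

lemma cblinop_minus: "cblinop S \<Longrightarrow> cblinop T \<Longrightarrow> cblinop (\<lambda>x. S x - T x)"
  by (rule bounded_linear_cblinop)
    (auto intro: bounded_linear_sub cblinop_bounded_linear simp: cblinop_scaleC scaleC_diff_right)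

lemma cblinop_scale: "cblinop S \<Longrightarrow> cblinop (\<lambda>x. r *\<^sub>R S x)"
  by (rule bounded_linear_cblinop[OF bounded_linear_compose[OF bounded_linear_scaleR_right
          cblinop_bounded_linear]])
    (auto simp: cblinop_scaleC scaleR_scaleC scaleC_scaleC mult.commute)

lemma cblinop_Pair: "cblinop S \<Longrightarrow> cblinop T \<Longrightarrow> cblinop (\<lambda>x. (S x, T x))"
  by (rule bounded_linear_cblinop)
    (auto intro: bounded_linear_Pair cblinop_bounded_linear simp: cblinop_scaleC)

lemma cblinop_fst: "cblinop fst"
  by (rule bounded_linear_cblinop) (auto intro: bounded_linear_fst simp: scaleC_prod_def)

lemma cblinop_funpow:
  fixes T :: "'a::chilbert \<Rightarrow> 'a"
  shows "cblinop T \<Longrightarrow> cblinop (T ^^ n)"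
proof (induction n)
  case 0
  then show ?case
    using cblinop_id by (simp add: id_def)
next
  case (Suc n)
  then show ?case
    using cblinop_compose[of T "T ^^ n"] by (simp add: comp_def)
qed

lemma
  assumes "cblinop T"
  shows csubspace_kernel: "csubspace {x. T x = 0}" and closed_kernel: "closed {x. T x = 0}"
proof -
  show "csubspace {x. T x = 0}"
    using assms by (auto simp: csubspace_def cblinop_0 cblinop_add cblinop_scaleC)
  show "closed {x. T x = 0}"
    using assms by (intro closed_Collect_eq continuous_on_const cblinop_continuous_on)
qed

lemma csubspace_image:
  assumes T: "cblinop T" and M: "csubspace M"
  shows "csubspace (T ` M)"
  unfolding csubspace_def
proof (intro conjI)
  show "0 \<in> T ` M"
    using cblinop_0[OF T] csubspace_0[OF M] by (metis imageI)
qed (use csubspace_add[OF M] csubspace_scaleC[OF M] in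
    \<open>auto simp flip: cblinop_add[OF T] cblinop_scaleC[OF T]\<close>)

lemmas csubspace_range = csubspace_image[OF _ csubspace_UNIV]

lemma cblinop_eq_if_eq_on_dense:
  assumes "cblinop S" "cblinop T" "closure M = UNIV" "\<And>x. x \<in> M \<Longrightarrow> S x = T x"
  shows "S = T"
proof
  show "S x = T x" for x
    by (rule continuous_on_closure_eqI[of M]) (simp_all add: assms cblinop_continuous_on)
qed

lemma cblinop_strong_limit:
  assumes B: "\<And>n::nat. cblinop (B n)" and K: "\<And>n x. norm (B n x) \<le> K * norm x"
    and lim: "\<And>x. (\<lambda>n. B n x) \<longlonglongrightarrow> A x"
  shows "cblinop A"
proof (rule cblinopI)
  show "A (x + y) = A x + A y" for x y
    using tendsto_add[OF lim[of x] lim[of y]] lim[of "x + y"]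
    by (simp add: cblinop_add[OF B] LIMSEQ_unique)
  show "A (scaleC c x) = scaleC c (A x)" for c x
    using tendsto_scaleC[OF lim[of x], of c] lim[of "scaleC c x"]
    by (simp add: cblinop_scaleC[OF B] LIMSEQ_unique)
  show "norm (A x) \<le> K * norm x" for x
    using tendsto_norm[OF lim[of x]] K by (intro LIMSEQ_le_const2) auto
qed

text \<open>The operators \<open>V\<^sub>T\<close> and \<open>\<gamma>\<^sub>T C\<close> are first given as linear relations, that is, subspaces of the
  product space; the norm bound makes these single-valued.\<close>

lemma bounded_linear_relation_function:
  fixes G :: "('a::chilbert \<times> 'b::chilbert) set"
  assumes G: "csubspace G" and bound: "\<And>a b. (a, b) \<in> G \<Longrightarrow> norm b \<le> K * norm a"
  obtains f where "clinear_on (fst ` G) f" "\<And>a b. (a, b) \<in> G \<Longrightarrow> f a = b"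
proof -
  have single_valued: "b = b'" if "(a, b) \<in> G" "(a, b') \<in> G" for a b b'
    using bound[of 0 "b - b'"] csubspace_diff[OF G that] by simp
  define f where "f a = (THE b. (a, b) \<in> G)" for a
  have f_eq: "f a = b" if "(a, b) \<in> G" for a b
    unfolding f_def using that single_valued by blast
  have "(fst p, f (fst p)) \<in> G" if "p \<in> G" for p
    using that f_eq[of "fst p" "snd p"] by simp
  then have graph: "(a, f a) \<in> G" if "a \<in> fst ` G" for a
    using that by blast
  have "clinear_on (fst ` G) f"
    unfolding clinear_on_def
  proof (intro conjI ballI allI)
    fix a b c assume "a \<in> fst ` G" "b \<in> fst ` G"
    then show "f (a + b) = f a + f b"
      using csubspace_add[OF G graph graph] by (intro f_eq) simp
    show "f (scaleC c a) = scaleC c (f a)"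
      using csubspace_scaleC[OF G graph[OF \<open>a \<in> fst ` G\<close>]] by (intro f_eq) simp
  qed
  then show ?thesis
    using that f_eq by blast
qed

lemma bounded_linear_relation_extension:
  fixes G :: "('a::chilbert \<times> 'b::chilbert) set"
  assumes G: "csubspace G" and bound: "\<And>a b. (a, b) \<in> G \<Longrightarrow> norm b \<le> K * norm a" and "K \<ge> 0"
  obtains F where "clinear_on (closure (fst ` G)) F" "K-lipschitz_on (closure (fst ` G)) F"
    "\<And>a b. (a, b) \<in> G \<Longrightarrow> F a = b"
proof -
  have domain: "csubspace (fst ` G)"
    by (rule csubspace_image[OF cblinop_fst G])
  obtain f where linear: "clinear_on (fst ` G) f"
    and graph: "\<And>a b. (a, b) \<in> G \<Longrightarrow> f a = b"
    using bounded_linear_relation_function[OF G bound] by blast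
  have "norm (f a) \<le> K * norm a" if "a \<in> fst ` G" for a
    using that graph bound by fastforce
  then have "K-lipschitz_on (fst ` G) f"
    using clinear_on_bounded_imp_lipschitz[OF linear domain _ \<open>K \<ge> 0\<close>] by blast
  then obtain F where lip: "K-lipschitz_on (closure (fst ` G)) F"
    and F: "\<And>a. a \<in> fst ` G \<Longrightarrow> F a = f a"
    using lipschitz_extend_closure by metis
  have "clinear_on (fst ` G) F"
    using linear csubspace_add[OF domain] csubspace_scaleC[OF domain] by (simp add: clinear_on_def F)
  then have "clinear_on (closure (fst ` G)) F"
    using clinear_on_closure domain lipschitz_on_continuous_on[OF lip] by blast
  moreover have "F a = b" if "(a, b) \<in> G" for a b
    using F[of a] graph[OF that] image_eqI[OF _ that, of a fst] by simp
  ultimately show ?thesis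
    using that lip by blast
qed

lemma isometric_factorization:
  fixes A :: "'a::chilbert \<Rightarrow> 'b::chilbert" and B :: "'a \<Rightarrow> 'c::chilbert"
  assumes A: "cblinop A" and B: "cblinop B" and norm_eq: "\<And>x. norm (B x) = norm (A x)"
  obtains V where "cisometry_on (closure (range A)) V" "\<And>x. V (A x) = B x"
proof -
  define G where "G = range (\<lambda>x. (A x, B x))"
  have dom: "fst ` G = range A"
    by (simp add: G_def image_image)
  have "csubspace G"
    unfolding G_def by (intro csubspace_range cblinop_Pair A B)
  moreover have "norm b \<le> 1 * norm a" if "(a, b) \<in> G" for a b
    using that norm_eq by (auto simp: G_def)
  ultimately obtain V where lin: "clinear_on (closure (range A)) V"
    and lip: "1-lipschitz_on (closure (range A)) V" and V_G: "\<And>a b. (a, b) \<in> G \<Longrightarrow> V a = b"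
    by (rule bounded_linear_relation_extension[of G 1, unfolded dom]) auto
  have V: "V (A x) = B x" for x
    by (rule V_G) (simp add: G_def)
  have "norm (V y) = norm y" if "y \<in> closure (range A)" for y
  proof (rule continuous_on_closure_eqI[OF _ _ _ that])
    show "norm (V z) = norm z" if "z \<in> range A" for z
      using that by (auto simp: V norm_eq)
  qed (intro continuous_on_norm continuous_on_id lipschitz_on_continuous_on[OF lip])+
  then have "cisometry_on (closure (range A)) V"
    using lin by (simp add: cisometry_on_def)
  then show ?thesis
    using that V by blast
qed

section \<open>Adjoints\<close>

lemma functional_eq_cinner_if_orthogonal_kernel:
  fixes f :: "'a::chilbert \<Rightarrow> complex"
  assumes add: "\<And>x y. f (x + y) = f x + f y" and scaleC: "\<And>c x. f (scaleC c x) = c * f x"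
    and "f w \<noteq> 0" and orthogonal: "\<And>z. f z = 0 \<Longrightarrow> cinner z w = 0"
  shows "f u = cinner (scaleC (cnj (f w) / cinner w w) w) u"
proof -
  have "w \<noteq> 0"
    using scaleC[of 0 0] \<open>f w \<noteq> 0\<close> by auto
  have "f (scaleC (f u / f w) w + scaleC (- 1) u) = 0"
    using \<open>f w \<noteq> 0\<close> by (simp add: add scaleC)
  then have "cinner w (scaleC (f u / f w) w + scaleC (- 1) u) = 0"
    using orthogonal by (subst cinner_commute) simp
  then have "f u = f w * cinner w u / cinner w w"
    using \<open>f w \<noteq> 0\<close> \<open>w \<noteq> 0\<close> by (auto simp: cinner_simps field_simps)
  moreover have "cnj (cinner w w) = cinner w w"
    by (rule cinner_commute[symmetric])
  ultimately show ?thesis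
    by (simp add: cinner_simps)
qed

lemma riesz_representation:
  fixes f :: "'a::chilbert \<Rightarrow> complex"
  assumes add: "\<And>x y. f (x + y) = f x + f y" and scaleC: "\<And>c x. f (scaleC c x) = c * f x"
    and bound: "\<And>x. norm (f x) \<le> K * norm x"
  shows "\<exists>z. \<forall>x. f x = cinner z x"
proof (cases "\<forall>x. f x = 0")
  case True
  then show ?thesis
    by (intro exI[of _ 0]) auto
next
  case False
  then obtain x where x: "f x \<noteq> 0"
    by blast
  interpret bounded_linear f
    by (rule bounded_linear_intro[where K = K])
      (auto simp: add scaleR_scaleC scaleC scaleR_conv_of_real mult.commute bound)
  let ?M = "{x. f x = 0}"
  have M: "csubspace ?M" "closed ?M"
    by (auto simp: csubspace_def zero add scaleC
        intro!: closed_Collect_eq continuous_on_const linear_continuous_on bounded_linear_axioms)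
  define w where "w = x - cproj ?M x"
  have "f w \<noteq> 0"
    using x cproj_in[OF M, of x] by (simp add: w_def diff)
  moreover have "cinner z w = 0" if "f z = 0" for z
    using cproj_orthogonal[OF M, of z x] that by (simp add: w_def)
  ultimately show ?thesis
    using functional_eq_cinner_if_orthogonal_kernel[OF add scaleC] by blast
qed

lemma cinner_cadj_right:
  fixes T :: "'a::chilbert \<Rightarrow> 'a"
  assumes T: "cblinop T"
  shows "cinner x (cadj T y) = cinner (T x) y"
proof -
  obtain K where K: "\<And>x. norm (T x) \<le> K * norm x"
    using cblinop_pos_bound[OF T] by blast
  have "\<exists>z. \<forall>x. cinner y (T x) = cinner z x" for y
  proof (rule riesz_representation[where K = "norm y * K"])
    show "norm (cinner y (T x)) \<le> norm y * K * norm x" for x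
      using norm_cinner_le[of y "T x"] mult_left_mono[OF K[of x] norm_ge_zero[of y]]
      by (simp add: mult.assoc)
  qed (auto simp: cblinop_add[OF T] cblinop_scaleC[OF T] cinner_simps)
  then obtain S where S: "\<And>x y. cinner y (T x) = cinner (S y) x"
    by metis
  have "cadj T = S"
    unfolding cadj_def
  proof (rule the_equality)
    show "\<forall>x y. cinner (T x) y = cinner x (S y)"
      using S by (subst (1 2) cinner_commute) simp
    then show "R = S" if "\<forall>x y. cinner (T x) y = cinner x (R y)" for R
      using that by (intro ext cinner_ext_right) metis
  qed
  then show ?thesis
    using S by (subst (1 2) cinner_commute) simp
qed

lemma cinner_cadj_left: "cblinop T \<Longrightarrow> cinner (cadj T x) y = cinner x (T (y::'a::chilbert))"
  by (subst (1 2) cinner_commute) (simp add: cinner_cadj_right)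

lemma cadj_eqI:
  assumes "cblinop T" "\<And>x y. cinner (T x) y = cinner x (S (y::'a::chilbert))"
  shows "cadj T = S"
  by (intro ext cinner_ext_right) (simp add: cinner_cadj_right assms)

lemma norm_cadj_le:
  fixes T :: "'a::chilbert \<Rightarrow> 'a"
  assumes T: "cblinop T" and K: "\<And>x. norm (T x) \<le> K * norm x"
  shows "norm (cadj T x) \<le> K * norm x"
proof (cases "cadj T x = 0")
  case True
  then show ?thesis
    using order_trans[OF norm_ge_zero K[of x]] by simp
next
  case False
  have "(norm (cadj T x))\<^sup>2 = Re (cinner (T (cadj T x)) x)"
    by (simp add: Re_cinner_self flip: cinner_cadj_right[OF T])
  also have "\<dots> \<le> norm (T (cadj T x)) * norm x"
    by (rule Re_cinner_le)
  also have "\<dots> \<le> K * norm (cadj T x) * norm x"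
    by (intro mult_right_mono K) auto
  finally show ?thesis
    using False by (simp add: power2_eq_square)
qed

lemma cblinop_cadj:
  assumes T: "cblinop T"
  shows "cblinop (cadj T)"
proof -
  obtain K where K: "\<And>x. norm (T x) \<le> K * norm x"
    using cblinop_pos_bound[OF T] by blast
  show ?thesis
  proof (rule cblinopI[OF _ _ norm_cadj_le[OF T K]])
    show "cadj T (x + y) = cadj T x + cadj T y" for x y
      by (rule cinner_ext_right) (simp add: cinner_simps cinner_cadj_right[OF T])
    show "cadj T (scaleC c x) = scaleC c (cadj T x)" for c x
      by (rule cinner_ext_right) (simp add: cinner_simps cinner_cadj_right[OF T])
  qed
qed

lemma cadj_funpow:
  fixes T :: "'a::chilbert \<Rightarrow> 'a"
  assumes T: "cblinop T"
  shows "cadj (T ^^ n) = cadj T ^^ n"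
proof (rule cadj_eqI[OF cblinop_funpow[OF T]])
  show "cinner ((T ^^ n) x) y = cinner x ((cadj T ^^ n) y)" for x y
  proof (induction n arbitrary: y)
    case (Suc n)
    have "cinner ((T ^^ Suc n) x) y = cinner ((T ^^ n) x) (cadj T y)"
      by (simp add: cinner_cadj_right[OF T])
    then show ?case
      unfolding Suc funpow_Suc_right by simp
  qed simp
qed

lemma sub_adj_eq_cproj_cadj:
  fixes T :: "'a::chilbert \<Rightarrow> 'a"
  assumes M: "csubspace M" "closed M" and T: "cblinop T" and S: "\<And>x. x \<in> M \<Longrightarrow> S x = T x"
    and y: "y \<in> M"
  shows "sub_adj M S y = cproj M (cadj T y)"
proof -
  let ?R = "\<lambda>y. if y \<in> M then cproj M (cadj T y) else 0"
  have cproj_cadj: "cinner x (cproj M (cadj T y)) = cinner (T x) y" if "x \<in> M" for x y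
    using cproj_orthogonal[OF M that, of "cadj T y"]
    by (simp add: cinner_diff_right cinner_cadj_right[OF T])
  have "sub_adj M S = ?R"
    unfolding sub_adj_def
  proof (rule the_equality)
    show "(\<forall>x. x \<notin> M \<longrightarrow> ?R x = 0) \<and> (\<forall>x\<in>M. ?R x \<in> M)
        \<and> (\<forall>x\<in>M. \<forall>y\<in>M. cinner (S x) y = cinner x (?R y))"
      by (simp add: cproj_in[OF M] cproj_cadj S)
    fix R assume R: "(\<forall>x. x \<notin> M \<longrightarrow> R x = 0) \<and> (\<forall>x\<in>M. R x \<in> M)
        \<and> (\<forall>x\<in>M. \<forall>y\<in>M. cinner (S x) y = cinner x (R y))"
    have "cproj M (cadj T y) = R y" if "y \<in> M" for y
      using R that by (intro cproj_eqI[OF M(1)])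
        (simp_all add: cinner_diff_right cinner_cadj_right[OF T] flip: S)
    then show "R = ?R"
      using R by (auto simp: fun_eq_iff)
  qed
  then show ?thesis
    using y by simp
qed

section \<open>Positive operators and their square roots\<close>

definition cselfadj :: "('a::chilbert \<Rightarrow> 'a) \<Rightarrow> bool" where
  "cselfadj B \<longleftrightarrow> cblinop B \<and> (\<forall>x y. cinner (B x) y = cinner x (B y))"

lemma cselfadj_cblinop: "cselfadj B \<Longrightarrow> cblinop B"
  and cselfadjD: "cselfadj B \<Longrightarrow> cinner (B x) y = cinner x (B y)"
  by (auto simp: cselfadj_def)

lemma cselfadj_plus: "cselfadj A \<Longrightarrow> cselfadj B \<Longrightarrow> cselfadj (\<lambda>x. A x + B x)"
  and cselfadj_minus: "cselfadj A \<Longrightarrow> cselfadj B \<Longrightarrow> cselfadj (\<lambda>x. A x - B x)"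
  and cselfadj_scale: "cselfadj A \<Longrightarrow> cselfadj (\<lambda>x. r *\<^sub>R A x)"
  by (auto simp: cselfadj_def cinner_simps intro: cblinop_plus cblinop_minus cblinop_scale)

lemma cselfadj_id: "cselfadj (\<lambda>x. x)"
  and cselfadj_zero: "cselfadj (\<lambda>x. 0)"
  by (simp_all add: cselfadj_def cblinop_id cblinop_zero)

lemma cselfadj_square: "cselfadj A \<Longrightarrow> cselfadj (\<lambda>x. A (A x))"
  by (simp add: cselfadj_def cblinop_compose)

lemma cselfadj_strong_limit:
  assumes B: "\<And>n::nat. cselfadj (B n)" and "\<And>n x. norm (B n x) \<le> K * norm x"
    and lim: "\<And>x. (\<lambda>n. B n x) \<longlonglongrightarrow> A x"
  shows "cselfadj A"
  unfolding cselfadj_def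
proof (intro conjI allI)
  show "cblinop A"
    using assms by (intro cblinop_strong_limit[of B K A] cselfadj_cblinop)
  show "cinner (A x) y = cinner x (A y)" for x y
    using tendsto_cinner[OF lim[of x] tendsto_const[of y]]
      tendsto_cinner[OF tendsto_const[of x] lim[of y]]
    by (simp add: cselfadjD[OF B] LIMSEQ_unique)
qed

lemma closure_range_cselfadj_square:
  assumes B: "cselfadj B"
  shows "closure (range (\<lambda>x. B (B x))) = closure (range B)"
proof
  let ?M = "closure (range (\<lambda>x. B (B x)))"
  show "?M \<subseteq> closure (range B)"
    by (rule closure_mono) auto
  have M: "csubspace ?M" "closed ?M"
    by (simp_all add: csubspace_closure csubspace_range cselfadj_cblinop cselfadj_square B)
  have "B x \<in> ?M" for x
  proof -
    define z where "z = B x - cproj ?M (B x)"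
    have z_orthogonal: "cinner u z = 0" if "u \<in> ?M" for u
      using cproj_orthogonal[OF M that] by (simp add: z_def)
    have "cinner (B (B z)) z = 0"
      by (intro z_orthogonal subsetD[OF closure_subset]) simp
    then have "B z = 0"
      unfolding cselfadjD[OF B, of "B z"] by (simp only: cinner_self_eq_0)
    then have "cinner (B x) z = 0"
      by (simp add: cselfadjD[OF B])
    moreover have "cinner (cproj ?M (B x)) z = 0"
      by (intro z_orthogonal cproj_in M)
    ultimately have "cinner z z = 0"
      by (subst (1) z_def) (simp add: cinner_diff_left)
    then have "cproj ?M (B x) = B x"
      by (simp add: z_def)
    then show ?thesis
      using cproj_in[OF M] by metis
  qed
  then show "closure (range B) \<subseteq> ?M"
    by (intro closure_minimal) auto
qed

lemma cpositive_imp_cselfadj: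
  assumes "cpositive B"
  shows "cselfadj B"
proof -
  have B: "cblinop B" and real: "\<And>x. Im (cinner x (B x)) = 0"
    using assms by (auto simp: cpositive_def)
  have "cinner (B x) y = cinner x (B y)" for x y
  proof -
    have "Im (cinner x (B y)) + Im (cinner y (B x)) = 0"
      using real[of "x + y"] real[of x] real[of y] by (simp add: cblinop_add[OF B] cinner_simps)
    moreover have "Re (cinner x (B y)) = Re (cinner y (B x))"
      using real[of "x + scaleC \<i> y"] real[of x] real[of y]
      by (simp add: cblinop_add[OF B] cblinop_scaleC[OF B] cinner_simps)
    ultimately have "cinner x (B y) = cnj (cinner y (B x))"
      by (simp add: complex_eq_iff)
    then show ?thesis
      by (simp add: cinner_commute[of "B x" y])
  qed
  then show ?thesis
    using B by (simp add: cselfadj_def)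
qed

lemma cpositiveI:
  assumes "cselfadj B" "\<And>x. 0 \<le> Re (cinner x (B x))"
  shows "cpositive B"
proof -
  have "cinner x (B x) = cnj (cinner x (B x))" for x
    using cselfadjD[OF assms(1), of x x] cinner_commute[of x "B x"] by simp
  then have "Im (cinner x (B x)) = 0" for x
    by (metis Reals_cnj_iff complex_is_Real_iff)
  then show ?thesis
    using assms by (simp add: cpositive_def cselfadj_cblinop)
qed

lemma cpositive_cblinop: "cpositive B \<Longrightarrow> cblinop B"
  and cpositive_nonneg: "cpositive B \<Longrightarrow> 0 \<le> Re (cinner x (B x))"
  by (auto simp: cpositive_def)

lemma cpositive_scale: "cpositive B \<Longrightarrow> 0 \<le> r \<Longrightarrow> cpositive (\<lambda>x. r *\<^sub>R B x)"
  by (intro cpositiveI)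
    (auto intro: cselfadj_scale cpositive_imp_cselfadj simp: cinner_simps cpositive_nonneg)

lemma cpositive_cadj_compose:
  fixes T :: "'a::chilbert \<Rightarrow> 'a"
  assumes T: "cblinop T"
  shows "cpositive (\<lambda>x. cadj T (T x))"
proof (rule cpositiveI)
  show "cselfadj (\<lambda>x. cadj T (T x))"
    by (simp add: cselfadj_def cblinop_compose cblinop_cadj T cinner_cadj_left cinner_cadj_right)
  show "0 \<le> Re (cinner x (cadj T (T x)))" for x
    by (simp add: cinner_cadj_right T Re_cinner_self)
qed

lemma cpositive_Cauchy_Schwarz:
  assumes B: "cpositive B"
  shows "(Re (cinner x (B y)))\<^sup>2 \<le> Re (cinner x (B x)) * Re (cinner y (B y))"
proof (rule nonneg_quadratic_imp_discriminant)
  fix t :: real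
  note lin = cpositive_cblinop[OF B]
  have "Re (cinner y (B x)) = Re (cinner x (B y))"
    using cselfadjD[OF cpositive_imp_cselfadj[OF B], of y x] Re_cinner_commute[of "B y" x] by simp
  then have "Re (cinner (x + t *\<^sub>R y) (B (x + t *\<^sub>R y)))
      = Re (cinner x (B x)) + 2 * t * Re (cinner x (B y)) + t\<^sup>2 * Re (cinner y (B y))"
    by (simp add: cblinop_add[OF lin] cblinop_scaleR[OF lin] cinner_simps power2_eq_square
        algebra_simps)
  then show "0 \<le> Re (cinner x (B x)) + 2 * t * Re (cinner x (B y)) + t\<^sup>2 * Re (cinner y (B y))"
    using cpositive_nonneg[OF B, of "x + t *\<^sub>R y"] by simp
qed

lemma norm_square_le_quadratic_form:
  assumes B: "cpositive B" and le: "\<And>x. Re (cinner x (B x)) \<le> K * (norm x)\<^sup>2"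
  shows "(norm (B x))\<^sup>2 \<le> K * Re (cinner x (B x))"
proof (cases "B x = 0")
  case True
  then show ?thesis
    by simp
next
  case False
  have "((norm (B x))\<^sup>2)\<^sup>2 \<le> Re (cinner (B x) (B (B x))) * Re (cinner x (B x))"
    using cpositive_Cauchy_Schwarz[OF B, of "B x" x] by (simp add: Re_cinner_self)
  also have "\<dots> \<le> K * (norm (B x))\<^sup>2 * Re (cinner x (B x))"
    by (intro mult_right_mono le cpositive_nonneg B)
  finally show ?thesis
    using False by (simp add: power2_eq_square)
qed

lemma Re_cinner_bounded_le:
  assumes "\<And>x. norm (B x) \<le> K * norm x"
  shows "Re (cinner x (B x)) \<le> K * (norm (x::'a::chilbert))\<^sup>2"
proof -
  have "norm x * norm (B x) \<le> norm x * (K * norm x)"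
    using assms by (intro mult_left_mono) auto
  then show ?thesis
    using Re_cinner_le[of x "B x"] by (simp add: power2_eq_square mult_ac)
qed

lemma cpositive_kernel:
  assumes B: "cpositive B" and "Re (cinner x (B x)) = 0"
  shows "B x = 0"
proof -
  obtain K where "\<And>x. norm (B x) \<le> K * norm x"
    using cblinop_pos_bound[OF cpositive_cblinop[OF B]] by blast
  then have "(norm (B x))\<^sup>2 \<le> K * Re (cinner x (B x))"
    by (intro norm_square_le_quadratic_form B Re_cinner_bounded_le)
  then show ?thesis
    by (simp add: assms(2))
qed

lemma decreasing_cpositive_convergent:
  fixes B :: "nat \<Rightarrow> 'a::chilbert \<Rightarrow> 'a"
  assumes pos: "\<And>n. cpositive (B n)" and dec: "\<And>x. decseq (\<lambda>n. Re (cinner x (B n x)))"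
    and le: "\<And>n x. Re (cinner x (B n x)) \<le> K * (norm x)\<^sup>2" and "K \<ge> 0"
  shows "convergent (\<lambda>n. B n x)"
proof -
  let ?q = "\<lambda>x n. Re (cinner x (B n x))"
  have diff: "(norm (B m x - B n x))\<^sup>2 \<le> K * (?q x m - ?q x n)" if "m \<le> n" for m n
  proof -
    have "cpositive (\<lambda>x. B m x - B n x)"
      using pos decseqD[OF dec that]
      by (auto intro!: cpositiveI cselfadj_minus simp: cinner_diff_right cpositive_imp_cselfadj)
    moreover have "Re (cinner x (B m x - B n x)) \<le> K * (norm x)\<^sup>2" for x
      using le[of x m] cpositive_nonneg[OF pos, of x n] by (simp add: cinner_diff_right)
    ultimately show ?thesis
      using norm_square_le_quadratic_form[of "\<lambda>x. B m x - B n x" K x] by (simp add: cinner_diff_right)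
  qed
  obtain L where L: "?q x \<longlonglongrightarrow> L" "\<And>n. L \<le> ?q x n"
    using decseq_convergent[OF dec] cpositive_nonneg[OF pos] by metis
  have "(dist (B m x) (B n x))\<^sup>2 \<le> K * (?q x m - L) + K * (?q x n - L)" for m n
  proof (induction m n rule: linorder_wlog)
    case (le m n)
    have "K * (?q x m - ?q x n) \<le> K * (?q x m - L) + K * (?q x n - L)"
      unfolding distrib_left[symmetric] using \<open>K \<ge> 0\<close> L(2)[of n] by (intro mult_left_mono) auto
    then show ?case
      using diff[OF le] by (simp add: dist_norm)
  qed (simp add: dist_commute add.commute)
  moreover have "(\<lambda>n. K * (?q x n - L)) \<longlonglongrightarrow> 0"
    using tendsto_mult_right_zero[OF LIM_zero[OF L(1)]] by simp
  ultimately show ?thesis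
    by (intro Cauchy_convergent Cauchy_if_dist_square_le)
qed

lemma decreasing_cpositive_strong_limit:
  fixes B :: "nat \<Rightarrow> 'a::chilbert \<Rightarrow> 'a"
  assumes pos: "\<And>n. cpositive (B n)" and dec: "\<And>x. decseq (\<lambda>n. Re (cinner x (B n x)))"
  obtains A where "cpositive A" "\<And>x. (\<lambda>n. B n x) \<longlonglongrightarrow> A x"
proof -
  obtain K where "K > 0" and K: "\<And>x. norm (B 0 x) \<le> K * norm x"
    using cblinop_pos_bound[OF cpositive_cblinop[OF pos]] by blast
  have le: "Re (cinner x (B n x)) \<le> K * (norm x)\<^sup>2" for n x
    using decseqD[OF dec, of 0 n x] Re_cinner_bounded_le[OF K, of x] by simp
  have "convergent (\<lambda>n. B n x)" for x
    using decreasing_cpositive_convergent[OF pos dec le] \<open>K > 0\<close> by simp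
  then obtain A where A: "\<And>x. (\<lambda>n. B n x) \<longlonglongrightarrow> A x"
    unfolding convergent_def by metis
  have "norm (B n x) \<le> K * norm x" for n x
  proof (rule power2_le_imp_le)
    have "(norm (B n x))\<^sup>2 \<le> K * Re (cinner x (B n x))"
      by (intro norm_square_le_quadratic_form pos le)
    also have "\<dots> \<le> K * (K * (norm x)\<^sup>2)"
      using \<open>K > 0\<close> le by (intro mult_left_mono) auto
    finally show "(norm (B n x))\<^sup>2 \<le> (K * norm x)\<^sup>2"
      by (simp add: power2_eq_square mult_ac)
  qed (use \<open>K > 0\<close> in simp)
  then have "cselfadj A"
    using pos A by (intro cselfadj_strong_limit[of B K A] cpositive_imp_cselfadj)
  moreover have "0 \<le> Re (cinner x (A x))" for x
    using tendsto_Re[OF tendsto_cinner[OF tendsto_const[of x] A[of x]]] cpositive_nonneg[OF pos]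
    by (intro LIMSEQ_le_const) auto
  ultimately show ?thesis
    using that A cpositiveI by blast
qed

lemma contraction_cblinop: "contraction T \<Longrightarrow> cblinop T"
  and contraction_norm_le: "contraction T \<Longrightarrow> norm (T x) \<le> norm x"
  by (auto simp: contraction_def)

lemma contraction_Re_cinner_le: "contraction T \<Longrightarrow> Re (cinner x (T x)) \<le> (norm x)\<^sup>2"
  using Re_cinner_bounded_le[of T 1 x] by (simp add: contraction_norm_le)

lemma
  assumes A: "cpositive A" "contraction A"
  shows cpositive_one_minus: "cpositive (\<lambda>x. x - A x)"
    and contraction_one_minus: "contraction (\<lambda>x. x - A x)"
proof -
  let ?Z = "\<lambda>x. x - A x"
  have form: "Re (cinner x (?Z x)) = (norm x)\<^sup>2 - Re (cinner x (A x))" for x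
    by (simp add: cinner_diff_right Re_cinner_self)
  then show Z: "cpositive ?Z"
    using A contraction_Re_cinner_le[OF A(2)]
    by (auto intro!: cpositiveI cselfadj_minus cselfadj_id simp: cpositive_imp_cselfadj)
  have le: "Re (cinner x (?Z x)) \<le> 1 * (norm x)\<^sup>2" for x
    unfolding form using cpositive_nonneg[OF A(1), of x] by simp
  have "norm (?Z x) \<le> norm x" for x
    using norm_square_le_quadratic_form[OF Z le, of x] le[of x] by (simp add: power2_le_imp_le)
  then show "contraction ?Z"
    using cpositive_cblinop[OF Z] by (simp add: contraction_def)
qed

text \<open>For a contraction \<open>Z\<close> the iterates converge to a solution \<open>1 - \<surd>(1 - Z)\<close> of \<open>2 Y = Z + Y\<^sup>2\<close>:
  they are dominated by the same iteration started with the scalar \<open>1\<close> in place of \<open>Z\<close>.\<close>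

primrec sqrt_iterate :: "('a::chilbert \<Rightarrow> 'a) \<Rightarrow> nat \<Rightarrow> 'a \<Rightarrow> 'a" where
  "sqrt_iterate Z 0 = (\<lambda>x. 0)"
| "sqrt_iterate Z (Suc n) =
    (\<lambda>x. (1/2) *\<^sub>R (Z x + sqrt_iterate Z n (sqrt_iterate Z n x)))"

primrec sqrt_majorant :: "nat \<Rightarrow> real" where
  "sqrt_majorant 0 = 0"
| "sqrt_majorant (Suc n) = (1 + (sqrt_majorant n)\<^sup>2) / 2"

lemma sqrt_majorant_nonneg: "0 \<le> sqrt_majorant n"
  by (induction n) auto

lemma sqrt_majorant_le_1: "sqrt_majorant n \<le> 1"
  by (induction n) (auto simp: abs_square_le_1 abs_of_nonneg sqrt_majorant_nonneg)

lemma incseq_sqrt_majorant: "incseq sqrt_majorant"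
proof (rule incseq_SucI)
  show "sqrt_majorant n \<le> sqrt_majorant (Suc n)" for n
    using zero_le_power2[of "1 - sqrt_majorant n"] by (simp add: power2_diff)
qed

lemma cselfadj_sqrt_iterate: "cselfadj Z \<Longrightarrow> cselfadj (sqrt_iterate Z n)"
  by (induction n) (simp_all add: cselfadj_zero cselfadj_scale cselfadj_plus cselfadj_square)

lemma cblinop_sqrt_iterate: "cblinop Z \<Longrightarrow> cblinop (sqrt_iterate Z n)"
  by (induction n) (simp_all add: cblinop_zero cblinop_scale cblinop_plus cblinop_compose)

lemma sqrt_iterate_commute:
  assumes C: "cblinop C" and "\<And>x. C (Z x) = Z (C x)"
  shows "C (sqrt_iterate Z n x) = sqrt_iterate Z n (C x)"
  by (induction n arbitrary: x)
    (auto simp: cblinop_0[OF C] cblinop_scaleR[OF C] cblinop_add[OF C] assms(2))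

lemma norm_sqrt_iterate_le:
  assumes Z: "contraction Z"
  shows "norm (sqrt_iterate Z n x) \<le> sqrt_majorant n * norm x"
proof (induction n arbitrary: x)
  case (Suc n)
  let ?Y = "sqrt_iterate Z n" and ?r = "sqrt_majorant n"
  have "norm (?Y (?Y x)) \<le> ?r * (?r * norm x)"
    using Suc[of "?Y x"] mult_left_mono[OF Suc[of x] sqrt_majorant_nonneg[of n]] by (rule order_trans)
  then have "norm (Z x + ?Y (?Y x)) \<le> norm x + ?r * (?r * norm x)"
    using contraction_norm_le[OF Z] by (intro norm_triangle_mono)
  then show ?case
    unfolding sqrt_iterate.simps norm_scaleR by (simp add: field_simps power2_eq_square)
qed simp

lemma contraction_sqrt_iterate:
  assumes Z: "contraction Z"
  shows "contraction (sqrt_iterate Z n)"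
  unfolding contraction_def
proof (intro conjI allI)
  show "norm (sqrt_iterate Z n x) \<le> norm x" for x
    using norm_sqrt_iterate_le[OF Z, of n x]
      mult_right_mono[OF sqrt_majorant_le_1[of n] norm_ge_zero[of x]] by simp
qed (intro cblinop_sqrt_iterate contraction_cblinop Z)

lemma norm_sqrt_iterate_diff_le:
  assumes Z: "contraction Z"
  shows "norm (sqrt_iterate Z (Suc n) x - sqrt_iterate Z n x)
    \<le> (sqrt_majorant (Suc n) - sqrt_majorant n) * norm x"
proof (induction n arbitrary: x)
  case 0
  then show ?case
    using contraction_norm_le[OF Z] by simp
next
  case (Suc n)
  define Y' Y where "Y' = sqrt_iterate Z (Suc n)" and "Y = sqrt_iterate Z n"
  define r' r where "r' = sqrt_majorant (Suc n)" and "r = sqrt_majorant n"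
  note lin = cblinop_sqrt_iterate[OF contraction_cblinop[OF Z]]
  have "sqrt_iterate Z (Suc (Suc n)) x - Y' x = (1/2) *\<^sub>R (Y' (Y' x) - Y (Y x))"
    unfolding Y'_def Y_def sqrt_iterate.simps by (simp flip: scaleR_diff_right)
  also have "Y' (Y' x) - Y (Y x) = Y' (Y' x - Y x) + (Y' (Y x) - Y (Y x))"
    unfolding Y'_def cblinop_diff[OF lin] by simp
  finally have "norm (sqrt_iterate Z (Suc (Suc n)) x - Y' x)
      \<le> (norm (Y' (Y' x - Y x)) + norm (Y' (Y x) - Y (Y x))) / 2"
    using norm_triangle_ineq[of "Y' (Y' x - Y x)" "Y' (Y x) - Y (Y x)"] by simp
  also have "norm (Y' (Y' x - Y x)) \<le> r' * ((r' - r) * norm x)"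
    using norm_sqrt_iterate_le[OF Z, of "Suc n" "Y' x - Y x"]
      mult_left_mono[OF Suc[of x] sqrt_majorant_nonneg[of "Suc n"]]
    unfolding Y'_def Y_def r'_def r_def by (rule order_trans)
  also have "norm (Y' (Y x) - Y (Y x)) \<le> (r' - r) * (r * norm x)"
  proof -
    have "(r' - r) * norm (Y x) \<le> (r' - r) * (r * norm x)"
      using incseq_SucD[OF incseq_sqrt_majorant, of n] norm_sqrt_iterate_le[OF Z, of n x]
      unfolding Y_def r'_def r_def by (intro mult_left_mono) auto
    then show ?thesis
      using Suc[of "Y x"] unfolding Y'_def Y_def r'_def r_def by linarith
  qed
  also have "(r' * ((r' - r) * norm x) + (r' - r) * (r * norm x)) / 2
      = ((1 + r'\<^sup>2) / 2 - (1 + r\<^sup>2) / 2) * norm x"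
    by (simp add: field_simps power2_eq_square)
  finally show ?case
    unfolding Y'_def r'_def r_def by simp
qed

lemma convergent_sqrt_iterate:
  assumes Z: "contraction Z"
  shows "convergent (\<lambda>n. sqrt_iterate Z n x)"
proof -
  obtain L where "sqrt_majorant \<longlonglongrightarrow> L"
    using incseq_convergent[OF incseq_sqrt_majorant] sqrt_majorant_le_1 by blast
  then have "summable (\<lambda>n. (sqrt_majorant (Suc n) - sqrt_majorant n) * norm x)"
    by (intro summable_mult2 telescope_summable)
  then have "summable (\<lambda>n. sqrt_iterate Z (Suc n) x - sqrt_iterate Z n x)"
    by (rule summable_comparison_test'[where N = 0]) (rule norm_sqrt_iterate_diff_le[OF Z])
  then show ?thesis
    unfolding summable_iff_convergent sum_lessThan_telescope[of "\<lambda>n. sqrt_iterate Z n x"] by simp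
qed

lemma sqrt_iterate_limit:
  fixes Z :: "'a::chilbert \<Rightarrow> 'a"
  assumes Z: "cselfadj Z" "contraction Z"
  obtains Y where "cselfadj Y" "contraction Y" "\<And>x. (\<lambda>n. sqrt_iterate Z n x) \<longlonglongrightarrow> Y x"
    "\<And>x. 2 *\<^sub>R Y x = Z x + Y (Y x)"
proof -
  let ?Y = "sqrt_iterate Z"
  note Yn = contraction_sqrt_iterate[OF Z(2)]
  obtain Y where lim: "\<And>x. (\<lambda>n. ?Y n x) \<longlonglongrightarrow> Y x"
    using convergent_sqrt_iterate[OF Z(2)] unfolding convergent_def by metis
  have Y: "cselfadj Y"
    using Z lim contraction_norm_le[OF Yn]
    by (intro cselfadj_strong_limit[of ?Y 1 Y] cselfadj_sqrt_iterate) auto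
  have "norm (Y x) \<le> norm x" for x
    using contraction_norm_le[OF Yn] by (intro LIMSEQ_le_const2[OF tendsto_norm[OF lim]]) auto
  then have "contraction Y"
    using cselfadj_cblinop[OF Y] by (simp add: contraction_def)
  moreover have "2 *\<^sub>R Y x = Z x + Y (Y x)" for x
  proof -
    have "(\<lambda>n. norm (?Y n x - Y x)) \<longlonglongrightarrow> 0"
      using tendsto_norm_zero[OF LIM_zero[OF lim]] .
    then have "(\<lambda>n. ?Y n (?Y n x - Y x)) \<longlonglongrightarrow> 0"
      by (rule Lim_null_comparison[rotated]) (simp add: contraction_norm_le[OF Yn])
    from tendsto_add[OF this lim[of "Y x"]] have "(\<lambda>n. ?Y n (?Y n x)) \<longlonglongrightarrow> Y (Y x)"
      by (simp add: cblinop_diff[OF contraction_cblinop[OF Yn]])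
    then have "(\<lambda>n. 2 *\<^sub>R ?Y (Suc n) x) \<longlonglongrightarrow> Z x + Y (Y x)"
      by (simp add: tendsto_add)
    moreover have "(\<lambda>n. 2 *\<^sub>R ?Y (Suc n) x) \<longlonglongrightarrow> 2 *\<^sub>R Y x"
      by (intro tendsto_scaleR tendsto_const LIMSEQ_Suc lim)
    ultimately show ?thesis
      using LIMSEQ_unique by blast
  qed
  ultimately show ?thesis
    using that Y lim by blast
qed

lemma cpositive_contraction_sqrt_exists:
  fixes A :: "'a::chilbert \<Rightarrow> 'a"
  assumes A: "cpositive A" "contraction A"
  shows "\<exists>S. cpositive S \<and> S \<circ> S = A \<and> (\<forall>C. cblinop C \<longrightarrow> C \<circ> A = A \<circ> C \<longrightarrow> C \<circ> S = S \<circ> C)"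
proof -
  define Z where "Z = (\<lambda>x. x - A x)"
  have Z: "cselfadj Z" "contraction Z"
    unfolding Z_def
    using cpositive_imp_cselfadj[OF cpositive_one_minus[OF A]] contraction_one_minus[OF A] .
  obtain Y where Y: "cselfadj Y" "contraction Y" and lim: "\<And>x. (\<lambda>n. sqrt_iterate Z n x) \<longlonglongrightarrow> Y x"
    and eq: "\<And>x. 2 *\<^sub>R Y x = Z x + Y (Y x)"
    using sqrt_iterate_limit[OF Z] by blast
  define S where "S = (\<lambda>x. x - Y x)"
  have "cpositive S"
    unfolding S_def using contraction_Re_cinner_le[OF Y(2)]
    by (auto intro!: cpositiveI cselfadj_minus cselfadj_id Y simp: cinner_diff_right Re_cinner_self)
  moreover have "S (S x) = A x" for x
    using eq[of x]
    by (simp add: S_def Z_def cblinop_diff[OF cselfadj_cblinop[OF Y(1)]] scaleR_2 algebra_simps)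
  then have "S \<circ> S = A"
    by (simp add: fun_eq_iff)
  moreover have "C \<circ> S = S \<circ> C" if C: "cblinop C" "C \<circ> A = A \<circ> C" for C
  proof
    fix x
    have "C (Z x) = Z (C x)" for x
      using fun_cong[OF C(2), of x] by (simp add: Z_def cblinop_diff[OF C(1)])
    then have "(\<lambda>n. sqrt_iterate Z n (C x)) \<longlonglongrightarrow> C (Y x)"
      using cblinop_tendsto[OF C(1) lim[of x]] by (simp add: sqrt_iterate_commute[OF C(1)])
    then have "C (Y x) = Y (C x)"
      using lim[of "C x"] by (rule LIMSEQ_unique)
    then show "(C \<circ> S) x = (S \<circ> C) x"
      by (simp add: S_def cblinop_diff[OF C(1)])
  qed
  ultimately show ?thesis
    by blast
qed

lemma cpositive_sqrt_exists:
  fixes A :: "'a::chilbert \<Rightarrow> 'a"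
  assumes A: "cpositive A"
  shows "\<exists>S. cpositive S \<and> S \<circ> S = A \<and> (\<forall>C. cblinop C \<longrightarrow> C \<circ> A = A \<circ> C \<longrightarrow> C \<circ> S = S \<circ> C)"
proof -
  obtain K where "K > 0" and K: "\<And>x. norm (A x) \<le> K * norm x"
    using cblinop_pos_bound[OF cpositive_cblinop[OF A]] by blast
  define A' where "A' = (\<lambda>x. (1 / K) *\<^sub>R A x)"
  have pos: "cpositive A'"
    unfolding A'_def using A \<open>K > 0\<close> by (intro cpositive_scale) auto
  have "contraction A'"
    using cpositive_cblinop[OF pos] K \<open>K > 0\<close>
    by (simp add: contraction_def A'_def pos_divide_le_eq mult.commute)
  then obtain R where R: "cpositive R" "R \<circ> R = A'"
    and comm: "\<And>C. cblinop C \<Longrightarrow> C \<circ> A' = A' \<circ> C \<Longrightarrow> C \<circ> R = R \<circ> C"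
    using cpositive_contraction_sqrt_exists[OF pos] by blast
  define S where "S = (\<lambda>x. sqrt K *\<^sub>R R x)"
  have "cpositive S"
    unfolding S_def using R(1) \<open>K > 0\<close> by (intro cpositive_scale) auto
  moreover have "S (S x) = A x" for x
    using fun_cong[OF R(2), of x] \<open>K > 0\<close>
    by (simp add: S_def A'_def cblinop_scaleR[OF cpositive_cblinop[OF R(1)]])
  then have "S \<circ> S = A"
    by (simp add: fun_eq_iff)
  moreover have "C \<circ> S = S \<circ> C" if C: "cblinop C" "C \<circ> A = A \<circ> C" for C
  proof -
    have "C \<circ> A' = A' \<circ> C"
      using C by (simp add: A'_def fun_eq_iff cblinop_scaleR)
    then show ?thesis
      using comm[OF C(1)] by (simp add: S_def fun_eq_iff cblinop_scaleR[OF C(1)])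
  qed
  ultimately show ?thesis
    by blast
qed

lemma commuting_cpositive_sqrt_unique:
  assumes R: "cpositive R" and S: "cpositive S" and eq: "R \<circ> R = S \<circ> S" and comm: "R \<circ> S = S \<circ> R"
  shows "R = S"
proof
  fix x
  note linR = cpositive_cblinop[OF R] and linS = cpositive_cblinop[OF S]
  define y where "y = R x - S x"
  have "R y + S y = 0"
    using fun_cong[OF eq, of x] fun_cong[OF comm, of x]
    by (simp add: y_def cblinop_diff[OF linR] cblinop_diff[OF linS])
  then have "Re (cinner y (R y)) + Re (cinner y (S y)) = 0"
    by (metis cinner_add_right cinner_zero_right plus_complex.sel(1) zero_complex.sel(1))
  then have "Re (cinner y (R y)) = 0" "Re (cinner y (S y)) = 0"
    using cpositive_nonneg[OF R, of y] cpositive_nonneg[OF S, of y] by linarith+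
  then have "R y = 0" "S y = 0"
    using cpositive_kernel R S by blast+
  then have "cinner y y = 0"
    using cselfadjD[OF cselfadj_minus[OF cpositive_imp_cselfadj[OF R] cpositive_imp_cselfadj[OF S]],
        of x y]
    by (simp add: y_def)
  then show "R x = S x"
    by (simp add: y_def)
qed

lemma
  assumes A: "cpositive A"
  shows cpositive_csqrt_op: "cpositive (csqrt_op A)"
    and csqrt_op_square: "csqrt_op A (csqrt_op A x) = A x"
proof -
  obtain S where S: "cpositive S" "S \<circ> S = A"
    and comm: "\<And>C. cblinop C \<Longrightarrow> C \<circ> A = A \<circ> C \<Longrightarrow> C \<circ> S = S \<circ> C"
    using cpositive_sqrt_exists[OF A] by blast
  have "csqrt_op A = S"
    unfolding csqrt_op_def
  proof (rule the_equality)
    fix R assume R: "cpositive R \<and> R \<circ> R = A"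
    then have "R \<circ> A = A \<circ> R"
      by (metis comp_assoc)
    then show "R = S"
      using R S comm cpositive_cblinop by (metis commuting_cpositive_sqrt_unique)
  qed (use S in blast)
  then show "cpositive (csqrt_op A)" "csqrt_op A (csqrt_op A x) = A x"
    using S(1) fun_cong[OF S(2), of x] by simp_all
qed

section \<open>The asymptotic limit of a contraction\<close>

lemma contraction_decseq_norm_funpow:
  assumes "contraction T"
  shows "decseq (\<lambda>n. norm ((T ^^ n) x))"
  by (rule decseq_SucI) (simp add: contraction_norm_le[OF assms])

lemma
  fixes T :: "'a::chilbert \<Rightarrow> 'a"
  assumes T: "contraction T"
  shows cpositive_AT: "cpositive (AT T)"
    and AT_tendsto: "(\<lambda>n. (cadj T ^^ n) ((T ^^ n) x)) \<longlonglongrightarrow> AT T x"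
proof -
  note lin = contraction_cblinop[OF T]
  let ?B = "\<lambda>n x. (cadj T ^^ n) ((T ^^ n) x)"
  have "cpositive (?B n)" for n
    using cpositive_cadj_compose[OF cblinop_funpow[OF lin]] by (simp add: cadj_funpow[OF lin])
  moreover have "decseq (\<lambda>n. Re (cinner x (?B n x)))" for x
    using decseqD[OF contraction_decseq_norm_funpow[OF T]]
    by (auto simp: decseq_def cinner_cadj_right cblinop_funpow lin Re_cinner_self power_mono
        simp flip: cadj_funpow[OF lin])
  ultimately obtain A where A: "cpositive A" "\<And>x. (\<lambda>n. ?B n x) \<longlonglongrightarrow> A x"
    using decreasing_cpositive_strong_limit[of ?B] by blast
  then have "AT T = A"
    by (auto simp: fun_eq_iff AT_def limI)
  then show "cpositive (AT T)" "(\<lambda>n. ?B n x) \<longlonglongrightarrow> AT T x"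
    using A by auto
qed

abbreviation AT_sqrt :: "('a::chilbert \<Rightarrow> 'a) \<Rightarrow> 'a \<Rightarrow> 'a" where
  "AT_sqrt T \<equiv> csqrt_op (AT T)"

lemma cselfadj_AT_sqrt: "contraction T \<Longrightarrow> cselfadj (AT_sqrt T)"
  by (intro cpositive_imp_cselfadj cpositive_csqrt_op cpositive_AT)

lemmas cblinop_AT_sqrt = cselfadj_cblinop[OF cselfadj_AT_sqrt]

lemma AT_sqrt_square: "contraction T \<Longrightarrow> AT_sqrt T (AT_sqrt T x) = AT T x"
  by (intro csqrt_op_square cpositive_AT)

lemma norm_funpow_tendsto:
  assumes T: "contraction T"
  shows "(\<lambda>n. norm ((T ^^ n) x)) \<longlonglongrightarrow> norm (AT_sqrt T x)"
proof -
  note lin = contraction_cblinop[OF T]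
  have "(\<lambda>n. Re (cinner x ((cadj T ^^ n) ((T ^^ n) x)))) \<longlonglongrightarrow> Re (cinner x (AT T x))"
    by (intro tendsto_Re tendsto_cinner tendsto_const AT_tendsto T)
  moreover have "cinner x ((cadj T ^^ n) ((T ^^ n) x)) = cinner ((T ^^ n) x) ((T ^^ n) x)" for n
    by (simp add: cinner_cadj_right cblinop_funpow lin flip: cadj_funpow[OF lin])
  moreover have "cinner x (AT T x) = cinner (AT_sqrt T x) (AT_sqrt T x)"
    by (simp add: cselfadjD[OF cselfadj_AT_sqrt[OF T]] AT_sqrt_square[OF T] del: cinner_self_eq_0)
  ultimately have "(\<lambda>n. (norm ((T ^^ n) x))\<^sup>2) \<longlonglongrightarrow> (norm (AT_sqrt T x))\<^sup>2"
    by (simp only: Re_cinner_self)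
  then show ?thesis
    using tendsto_real_sqrt by fastforce
qed

lemma norm_AT_sqrt_shift:
  assumes T: "contraction T"
  shows "norm (AT_sqrt T (T x)) = norm (AT_sqrt T x)"
proof -
  have "(\<lambda>n. norm ((T ^^ n) (T x))) \<longlonglongrightarrow> norm (AT_sqrt T x)"
    using LIMSEQ_Suc[OF norm_funpow_tendsto[OF T, of x]] by (simp add: funpow_swap1)
  with norm_funpow_tendsto[OF T, of "T x"] show ?thesis
    by (rule LIMSEQ_unique)
qed

lemma H0_eq_kernel:
  assumes T: "contraction T"
  shows "H0 T = {x. AT_sqrt T x = 0}"
proof -
  have "(\<lambda>n. (T ^^ n) x) \<longlonglongrightarrow> 0 \<longleftrightarrow> norm (AT_sqrt T x) = 0" for x
    using norm_funpow_tendsto[OF T, of x] LIMSEQ_unique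
    unfolding tendsto_norm_zero_iff[symmetric, of "\<lambda>n. (T ^^ n) x"] by metis
  then show ?thesis
    by (simp add: H0_def)
qed

lemma csubspace_H0: "contraction T \<Longrightarrow> csubspace (H0 T)"
  and closed_H0: "contraction T \<Longrightarrow> closed (H0 T)"
  by (simp_all add: H0_eq_kernel csubspace_kernel closed_kernel cblinop_AT_sqrt)

lemma H0_invariant:
  assumes "x \<in> H0 T"
  shows "T x \<in> H0 T"
  using LIMSEQ_Suc[of "\<lambda>n. (T ^^ n) x" 0] assms by (simp add: H0_def funpow_swap1)

lemma RT_eq_closure_range_AT_sqrt:
  assumes T: "contraction T"
  shows "RT T = closure (range (AT_sqrt T))"
  using closure_range_cselfadj_square[OF cselfadj_AT_sqrt[OF T]] by (simp add: RT_def AT_sqrt_square[OF T])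

lemma AT_sqrt_in_RT: "contraction T \<Longrightarrow> AT_sqrt T x \<in> RT T"
  using closure_subset[of "range (AT_sqrt T)"] by (auto simp: RT_eq_closure_range_AT_sqrt)

lemma csubspace_RT: "contraction T \<Longrightarrow> csubspace (RT T)"
  by (simp add: RT_eq_closure_range_AT_sqrt csubspace_closure csubspace_range cblinop_AT_sqrt)

definition asymptotic_isometry :: "('a::chilbert \<Rightarrow> 'a) \<Rightarrow> ('a \<Rightarrow> 'a) \<Rightarrow> bool" where
  "asymptotic_isometry T V \<longleftrightarrow> (\<forall>x. x \<notin> RT T \<longrightarrow> V x = 0) \<and> V ` RT T \<subseteq> RT T
     \<and> cisometry_on (RT T) V \<and> (\<forall>x. AT_sqrt T (T x) = V (AT_sqrt T x))"

lemma VT_eq_The: "VT T = (THE V. asymptotic_isometry T V)"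
  unfolding VT_def asymptotic_isometry_def cisometry_on_def clinear_on_def image_subset_iff
  by (simp only: conj_assoc)

lemma asymptotic_isometry_exists:
  assumes T: "contraction T"
  shows "\<exists>V. asymptotic_isometry T V"
proof -
  let ?S = "AT_sqrt T"
  note RT = RT_eq_closure_range_AT_sqrt[OF T] and sub = csubspace_RT[OF T]
  obtain F where iso: "cisometry_on (RT T) F" and F: "\<And>x. F (?S x) = ?S (T x)"
    using isometric_factorization[of ?S "\<lambda>x. ?S (T x)"] cblinop_AT_sqrt[OF T]
      cblinop_compose[OF _ contraction_cblinop[OF T]] norm_AT_sqrt_shift[OF T]
    unfolding RT by metis
  have cont: "continuous_on (closure (range ?S)) F"
    using cisometry_on_continuous_on[OF iso sub] by (simp only: RT)
  have "F ` closure (range ?S) \<subseteq> RT T"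
  proof (rule image_closure_subset[OF cont])
    show "closed (RT T)"
      by (simp add: RT_def)
  qed (auto simp: F AT_sqrt_in_RT[OF T])
  then have F_RT: "F ` RT T \<subseteq> RT T"
    by (simp only: RT)
  define V where "V x = (if x \<in> RT T then F x else 0)" for x
  have "cisometry_on (RT T) V"
    using iso csubspace_add[OF sub] csubspace_scaleC[OF sub]
    by (simp add: cisometry_on_def clinear_on_def V_def)
  then have "asymptotic_isometry T V"
    using F_RT F AT_sqrt_in_RT[OF T] by (auto simp: asymptotic_isometry_def V_def)
  then show ?thesis
    by blast
qed

lemma asymptotic_isometry_unique:
  assumes T: "contraction T" and V: "asymptotic_isometry T V" and V': "asymptotic_isometry T V'"
  shows "V = V'"
proof
  fix x
  have cont: "continuous_on (closure (range (AT_sqrt T))) U" if "asymptotic_isometry T U" for U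
    using that cisometry_on_continuous_on[OF _ csubspace_RT[OF T], of U]
    unfolding asymptotic_isometry_def RT_eq_closure_range_AT_sqrt[OF T] by blast
  show "V x = V' x"
  proof (cases "x \<in> RT T")
    case True
    then show ?thesis
      unfolding RT_eq_closure_range_AT_sqrt[OF T]
      by (rule continuous_on_closure_eqI[OF cont[OF V] cont[OF V'], rotated])
        (use V V' in \<open>auto simp: asymptotic_isometry_def\<close>)
  next
    case False
    then show ?thesis
      using V V' by (simp add: asymptotic_isometry_def)
  qed
qed

lemma VT_asymptotic_isometry:
  assumes T: "contraction T"
  shows "asymptotic_isometry T (VT T)"
proof -
  have "\<exists>!V. asymptotic_isometry T V"
    using asymptotic_isometry_exists[OF T] asymptotic_isometry_unique[OF T] by blast
  then show ?thesis
    unfolding VT_eq_The by (rule theI')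
qed

section \<open>The commutant mapping\<close>

lemma commutant_cblinop: "C \<in> commutant T \<Longrightarrow> cblinop C"
  and commutantD: "C \<in> commutant T \<Longrightarrow> C (T x) = T (C x)"
  by (simp_all add: commutant_def fun_eq_iff)

lemma commutantI: "cblinop C \<Longrightarrow> (\<And>x. C (T x) = T (C x)) \<Longrightarrow> C \<in> commutant T"
  by (simp add: commutant_def fun_eq_iff)

lemma commutant_funpow: "C \<in> commutant T \<Longrightarrow> C ((T ^^ n) x) = (T ^^ n) (C x)"
  by (induction n) (simp_all add: commutantD[of C T])

lemma
  assumes W: "unitary_op W"
  shows cadj_unitary_left: "cadj W (W x) = x" and cadj_unitary_right: "W (cadj W x) = x"
    and norm_cadj_unitary: "norm (cadj W x) = norm x"
proof -
  have lin: "cblinop W" and norm: "\<And>x. norm (W x) = norm x" and surj: "surj W"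
    using W by (auto simp: unitary_op_def)
  have left: "cadj W (W x) = x" for x
  proof (rule eq_if_norm_le_Re_cinner_eq)
    show "norm (cadj W (W x)) \<le> norm x"
      using norm_cadj_le[OF lin, of 1 "W x"] by (simp add: norm)
    show "Re (cinner (cadj W (W x)) x) = (norm x)\<^sup>2"
      by (simp add: cinner_cadj_left[OF lin] Re_cinner_self norm)
  qed
  then show "cadj W (W x) = x" .
  show right: "W (cadj W x) = x"
    using surj left by (metis surjD)
  then show "norm (cadj W x) = norm x"
    by (metis norm)
qed

lemma commutant_unitary_cadj:
  assumes "unitary_op W" "D \<in> commutant W"
  shows "D \<in> commutant (cadj W)"
proof (rule commutantI)
  show "D (cadj W x) = cadj W (D x)" for x
    using cadj_unitary_left[OF assms(1)] cadj_unitary_right[OF assms(1)] commutantD[OF assms(2)]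
    by metis
qed (rule commutant_cblinop[OF assms(2)])

locale dilated_contraction =
  fixes T :: "'a::chilbert \<Rightarrow> 'a" and J :: "'a \<Rightarrow> 'b::chilbert" and W :: "'b \<Rightarrow> 'b"
  assumes T: "contraction T" and dilation: "min_unitary_dilation (RT T) (VT T) J W"
begin

abbreviation "X \<equiv> XT T J"
abbreviation "U \<equiv> cadj W"

lemma J_isometry: "cisometry_on (RT T) J"
  using dilation by (simp add: min_unitary_dilation_def cisometry_on_def clinear_on_def)

lemma W_unitary: "unitary_op W"
  and J_cinner: "x \<in> RT T \<Longrightarrow> y \<in> RT T \<Longrightarrow>
      cinner (J y) ((W ^^ n) (J x)) = cinner y ((VT T ^^ n) x)"
  and minimal: "clspan (\<Union>n. (W ^^ n) ` J ` RT T \<union> (U ^^ n) ` J ` RT T) = UNIV"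
  using dilation unfolding min_unitary_dilation_def by simp_all

lemma W_cblinop: "cblinop W" and norm_W: "norm (W x) = norm x"
  using W_unitary by (auto simp: unitary_op_def)

lemma J_VT:
  assumes x: "x \<in> RT T"
  shows "J (VT T x) = W (J x)"
proof (rule eq_if_norm_le_Re_cinner_eq)
  have V: "VT T x \<in> RT T" "norm (VT T x) = norm x"
    using VT_asymptotic_isometry[OF T] x by (auto simp: asymptotic_isometry_def cisometry_on_def)
  show "norm (J (VT T x)) \<le> norm (W (J x))"
    by (simp add: norm_W cisometry_on_norm[OF J_isometry] V x)
  show "Re (cinner (J (VT T x)) (W (J x))) = (norm (W (J x)))\<^sup>2"
    using J_cinner[OF x V(1), of 1]
    by (simp add: Re_cinner_self norm_W cisometry_on_norm[OF J_isometry] V(2) x)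
qed

lemma norm_X: "norm (X x) = norm (AT_sqrt T x)"
  by (simp add: XT_def cisometry_on_norm[OF J_isometry] AT_sqrt_in_RT[OF T])

lemma X_cblinop: "cblinop X"
proof -
  note S = cblinop_AT_sqrt[OF T] and J = cisometry_on_clinear_on[OF J_isometry]
  obtain K where K: "\<And>x. norm (AT_sqrt T x) \<le> K * norm x"
    using cblinop_pos_bound[OF S] by blast
  show ?thesis
  proof (rule cblinopI)
    show "X (x + y) = X x + X y" for x y
      by (simp add: XT_def cblinop_add[OF S] clinear_on_add[OF J] AT_sqrt_in_RT[OF T])
    show "X (scaleC c x) = scaleC c (X x)" for c x
      by (simp add: XT_def cblinop_scaleC[OF S] clinear_on_scaleC[OF J] AT_sqrt_in_RT[OF T])
    show "norm (X x) \<le> K * norm x" for x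
      using K by (simp add: norm_X)
  qed
qed

lemma X_eq_0_iff: "X x = 0 \<longleftrightarrow> x \<in> H0 T"
proof -
  have "X x = 0 \<longleftrightarrow> AT_sqrt T x = 0"
    using norm_X[of x] by (metis norm_eq_zero)
  then show ?thesis
    by (simp add: H0_eq_kernel[OF T])
qed

lemma X_T: "X (T x) = W (X x)"
  using VT_asymptotic_isometry[OF T] J_VT[OF AT_sqrt_in_RT[OF T]]
  by (simp add: XT_def asymptotic_isometry_def)

lemma norm_X_commutant_le:
  assumes C: "C \<in> commutant T" and K: "\<And>x. norm (C x) \<le> K * norm x"
  shows "norm (X (C x)) \<le> K * norm (X x)"
  unfolding norm_X
proof (rule LIMSEQ_le)
  show "(\<lambda>n. norm ((T ^^ n) (C x))) \<longlonglongrightarrow> norm (AT_sqrt T (C x))"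
    by (rule norm_funpow_tendsto[OF T])
  show "(\<lambda>n. K * norm ((T ^^ n) x)) \<longlonglongrightarrow> K * norm (AT_sqrt T x)"
    by (intro tendsto_mult_left norm_funpow_tendsto[OF T])
  show "\<exists>N. \<forall>n\<ge>N. norm ((T ^^ n) (C x)) \<le> K * norm ((T ^^ n) x)"
    using K by (simp flip: commutant_funpow[OF C])
qed

definition lift_graph :: "('a \<Rightarrow> 'a) \<Rightarrow> ('b \<times> 'b) set" where
  "lift_graph C = (\<Union>n. range (\<lambda>x. ((U ^^ n) (X x), (U ^^ n) (X (C x)))))"

definition backward_orbit :: "'b set" where
  "backward_orbit = (\<Union>n. range (\<lambda>x. (U ^^ n) (X x)))"

lemma fst_lift_graph: "fst ` lift_graph C = backward_orbit"
  by (simp add: lift_graph_def backward_orbit_def image_UN image_image)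

lemma U_funpow_X_shift: "(U ^^ n) (X x) = (U ^^ Suc n) (X (T x))"
  unfolding funpow_Suc_right by (simp add: X_T cadj_unitary_left[OF W_unitary])

lemma lift_graph_csubspace:
  assumes C: "C \<in> commutant T"
  shows "csubspace (lift_graph C)"
  unfolding lift_graph_def
proof (rule csubspace_incseq_Union)
  let ?g = "\<lambda>n x. ((U ^^ n) (X x), (U ^^ n) (X (C x)))"
  have "?g n x = ?g (Suc n) (T x)" for n x
    using U_funpow_X_shift[of n x] U_funpow_X_shift[of n "C x"] by (simp only: commutantD[OF C])
  then have "range (?g n) \<subseteq> range (?g (Suc n))" for n
    by (metis (no_types, lifting) image_subset_iff rangeI)
  then show "incseq (\<lambda>n. range (?g n))"
    by (rule incseq_SucI)
  have U: "cblinop (U ^^ n)" for n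
    by (intro cblinop_funpow cblinop_cadj W_cblinop)
  show "csubspace (range (?g n))" for n
    by (intro csubspace_range cblinop_Pair cblinop_compose[OF U] X_cblinop
        cblinop_compose[OF X_cblinop] commutant_cblinop[OF C])
qed

lemma backward_orbit_csubspace: "csubspace backward_orbit"
proof -
  have "(\<lambda>x. x) \<in> commutant T"
    by (simp add: commutantI cblinop_id)
  then have "csubspace (fst ` lift_graph (\<lambda>x. x))"
    by (intro csubspace_image cblinop_fst lift_graph_csubspace)
  then show ?thesis
    by (simp add: fst_lift_graph)
qed

lemma backward_orbitI: "(U ^^ n) (X x) \<in> backward_orbit"
  by (auto simp: backward_orbit_def)

lemma W_U_funpow_X: "W ((U ^^ n) (X x)) = (U ^^ n) (X (T x))"
  using U_funpow_X_shift[of n x] cadj_unitary_right[OF W_unitary] by simp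

lemma W_backward_orbit: "W ` backward_orbit \<subseteq> backward_orbit"
proof -
  have "W ((U ^^ n) (X x)) \<in> backward_orbit" for n x
    unfolding W_U_funpow_X by (rule backward_orbitI)
  then show ?thesis
    by (subst backward_orbit_def) auto
qed

lemma U_backward_orbit: "U ` backward_orbit \<subseteq> backward_orbit"
proof -
  have "U ((U ^^ n) (X x)) \<in> backward_orbit" for n x
    using backward_orbitI[of "Suc n" x] by simp
  then show ?thesis
    by (subst backward_orbit_def) auto
qed

lemma backward_orbit_dense: "closure backward_orbit = UNIV"
proof -
  have invariant: "(A ^^ n) v \<in> closure backward_orbit"
    if "cblinop A" "A ` backward_orbit \<subseteq> backward_orbit" "v \<in> closure backward_orbit" for A n v
  proof (induction n)
    case (Suc n)
    then have "A ((A ^^ n) v) \<in> closure (A ` backward_orbit)"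
      using closure_bounded_linear_image_subset[OF cblinop_bounded_linear[OF that(1)]] by blast
    then show ?case
      using closure_mono[OF that(2)] by auto
  qed (simp add: that(3))
  have "X x \<in> backward_orbit" for x
    using backward_orbitI[of 0 x] by simp
  then have "J ` range (AT_sqrt T) \<subseteq> closure backward_orbit"
    using closure_subset by (auto simp: XT_def)
  then have "J ` RT T \<subseteq> closure backward_orbit"
    using cisometry_on_continuous_on[OF J_isometry csubspace_RT[OF T]]
    unfolding RT_eq_closure_range_AT_sqrt[OF T] by (intro image_closure_subset) auto
  then have "clspan (\<Union>n. (W ^^ n) ` J ` RT T \<union> (U ^^ n) ` J ` RT T) \<subseteq> closure backward_orbit"
    using invariant[OF W_cblinop W_backward_orbit]
      invariant[OF cblinop_cadj[OF W_cblinop] U_backward_orbit]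
    by (intro clspan_minimal csubspace_closure[OF backward_orbit_csubspace]) auto
  then show ?thesis
    using minimal by auto
qed

lemma cblinop_eq_if_eq_on_backward_orbit:
  assumes "cblinop D" "cblinop E" "\<And>n x. D ((U ^^ n) (X x)) = E ((U ^^ n) (X x))"
  shows "D = E"
  by (rule cblinop_eq_if_eq_on_dense[OF assms(1,2) backward_orbit_dense])
    (auto simp: backward_orbit_def assms(3))

lemma commutant_lift_exists:
  assumes C: "C \<in> commutant T"
  shows "\<exists>D. D \<in> commutant W \<and> (\<forall>x. X (C x) = D (X x))"
proof -
  obtain K where "K > 0" and K: "\<And>x. norm (C x) \<le> K * norm x"
    using cblinop_pos_bound[OF commutant_cblinop[OF C]] by blast
  have "norm ((U ^^ n) v) = norm v" for n v
    by (induction n) (simp_all add: norm_cadj_unitary[OF W_unitary])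
  then have "norm b \<le> K * norm a" if "(a, b) \<in> lift_graph C" for a b
    using that norm_X_commutant_le[OF C K] by (auto simp: lift_graph_def)
  then obtain D where lin: "clinear_on UNIV D" and lip: "K-lipschitz_on UNIV D"
    and D_graph: "\<And>a b. (a, b) \<in> lift_graph C \<Longrightarrow> D a = b"
    using bounded_linear_relation_extension[OF lift_graph_csubspace[OF C]] \<open>K > 0\<close>
    unfolding fst_lift_graph backward_orbit_dense by (metis less_imp_le)
  have D: "D ((U ^^ n) (X x)) = (U ^^ n) (X (C x))" for n x
    by (rule D_graph) (auto simp: lift_graph_def)
  have "D 0 = 0"
    using clinear_on_scaleC[OF lin, of 0 0] by simp
  then have "norm (D v) \<le> K * norm v" for v
    using lipschitz_on_normD[OF lip, of v 0] by simp
  then have linD: "cblinop D"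
    using lin by (intro cblinopI) (auto simp: clinear_on_def)
  have "(\<lambda>v. D (W v)) = (\<lambda>v. W (D v))"
    by (rule cblinop_eq_if_eq_on_backward_orbit)
      (auto intro: cblinop_compose linD W_cblinop simp: D W_U_funpow_X commutantD[OF C])
  then have "D \<in> commutant W"
    using linD by (intro commutantI) (auto simp: fun_eq_iff)
  then show ?thesis
    using D[of 0] by auto
qed

lemma commutant_lift_unique:
  assumes D: "D \<in> commutant W" "\<forall>x. X (C x) = D (X x)"
    and E: "E \<in> commutant W" "\<forall>x. X (C x) = E (X x)"
  shows "D = E"
proof (rule cblinop_eq_if_eq_on_backward_orbit)
  show "D ((U ^^ n) (X x)) = E ((U ^^ n) (X x))" for n x
    using commutant_funpow[OF commutant_unitary_cadj[OF W_unitary D(1)]]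
      commutant_funpow[OF commutant_unitary_cadj[OF W_unitary E(1)]] D(2) E(2) by metis
qed (use D(1) E(1) commutant_cblinop in blast)+

lemma X_commutant_eq_gammaT:
  assumes "C \<in> commutant T"
  shows "X (C x) = gammaT T J W C (X x)"
proof -
  have "\<exists>!D. D \<in> commutant W \<and> (\<forall>x. X (C x) = D (X x))"
    using commutant_lift_exists[OF assms] commutant_lift_unique by blast
  from theI'[OF this] show ?thesis
    unfolding gammaT_def by blast
qed

lemma gammaT_eq_iff:
  assumes C: "C \<in> commutant T" and C': "C' \<in> commutant T"
  shows "gammaT T J W C = gammaT T J W C' \<longleftrightarrow> range (\<lambda>x. C x - C' x) \<subseteq> H0 T"
proof -
  have "gammaT T J W C = gammaT T J W C' \<longleftrightarrow> (\<forall>x. X (C x) = X (C' x))"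
  proof
    assume "gammaT T J W C = gammaT T J W C'"
    then show "\<forall>x. X (C x) = X (C' x)"
      by (simp add: X_commutant_eq_gammaT C C')
  qed (simp add: gammaT_def)
  also have "\<dots> \<longleftrightarrow> (\<forall>x. C x - C' x \<in> H0 T)"
    by (simp add: cblinop_diff[OF X_cblinop] flip: X_eq_0_iff)
  finally show ?thesis
    by blast
qed

lemma inj_gammaT_iff:
  "inj_on (gammaT T J W) (commutant T) \<longleftrightarrow>
    (\<forall>C\<in>commutant T. range C \<subseteq> H0 T \<longrightarrow> C = (\<lambda>x. 0))"
proof
  have zero: "(\<lambda>x. 0) \<in> commutant T"
    using cblinop_0[OF contraction_cblinop[OF T]] by (simp add: commutantI cblinop_zero)
  assume inj: "inj_on (gammaT T J W) (commutant T)"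
  show "\<forall>C\<in>commutant T. range C \<subseteq> H0 T \<longrightarrow> C = (\<lambda>x. 0)"
    using gammaT_eq_iff[OF _ zero] inj_onD[OF inj _ _ zero] by simp
next
  assume ker: "\<forall>C\<in>commutant T. range C \<subseteq> H0 T \<longrightarrow> C = (\<lambda>x. 0)"
  show "inj_on (gammaT T J W) (commutant T)"
  proof (rule inj_onI)
    fix C D assume CD: "C \<in> commutant T" "D \<in> commutant T" "gammaT T J W C = gammaT T J W D"
    have "(\<lambda>x. C x - D x) \<in> commutant T"
      using cblinop_minus[OF CD(1,2)[THEN commutant_cblinop]]
      by (rule commutantI)
        (simp add: commutantD[OF CD(1)] commutantD[OF CD(2)] cblinop_diff[OF contraction_cblinop[OF T]])
    then have "(\<lambda>x. C x - D x) = (\<lambda>x. 0)"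
      using ker gammaT_eq_iff[OF CD(1,2)] CD(3) by blast
    then show "C = D"
      by (simp add: fun_eq_iff)
  qed
qed

end

section \<open>Root vectors and injectivity\<close>

lemma psp_on_iff: "l \<in> psp_on M S \<longleftrightarrow> (\<exists>x\<in>M. x \<noteq> 0 \<and> S x = scaleC l x)"
  by (simp add: psp_on_def)

lemma eigenvalue_if_root_vector:
  assumes "((\<lambda>y. A y - scaleC l y) ^^ j) x = 0" "x \<noteq> (0::'a::chilbert)"
  shows "l \<in> psp A"
  using assms
proof (induction j arbitrary: x)
  case (Suc j)
  show ?case
  proof (cases "A x - scaleC l x = 0")
    case True
    then show ?thesis
      using Suc.prems(2) by (auto simp: psp_on_iff)
  next
    case False
    then show ?thesis
      using Suc.IH Suc.prems(1) by (simp add: funpow_Suc_right del: funpow.simps)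
  qed
qed simp

lemma gen_root_system_eq_0:
  assumes gen: "gen_root_system M B" and R: "cblinop R"
    and root: "\<And>l j x. l \<in> psp_on M B \<Longrightarrow> x \<in> M \<Longrightarrow> ((\<lambda>y. B y - scaleC l y) ^^ j) x = 0 \<Longrightarrow> R x = 0"
    and "x \<in> M"
  shows "R x = 0"
proof -
  note ker = csubspace_kernel[OF R] closed_kernel[OF R]
  have "root_subspace M B l \<subseteq> {x. R x = 0}" if "l \<in> psp_on M B" for l
    unfolding root_subspace_def by (rule clspan_minimal[OF _ ker]) (use root[OF that] in auto)
  then have "clspan (\<Union>l\<in>psp_on M B. root_subspace M B l) \<subseteq> {x. R x = 0}"
    by (intro clspan_minimal ker) blast
  then show ?thesis
    using gen \<open>x \<in> M\<close> unfolding gen_root_system_def by blast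
qed

lemma intertwining_funpow_diff:
  assumes R: "cblinop R" and M: "csubspace M" and B: "\<And>x. x \<in> M \<Longrightarrow> B x \<in> M"
    and intertwines: "\<And>x. x \<in> M \<Longrightarrow> R (B x) = A (R x)" and x: "x \<in> M"
  shows "R (((\<lambda>y. B y - scaleC l y) ^^ j) x) = ((\<lambda>y. A y - scaleC l y) ^^ j) (R x)"
proof -
  let ?N = "\<lambda>y. B y - scaleC l y"
  have "(?N ^^ j) x \<in> M \<and> R ((?N ^^ j) x) = ((\<lambda>y. A y - scaleC l y) ^^ j) (R x)"
  proof (induction j)
    case (Suc j)
    then have "?N ((?N ^^ j) x) \<in> M"
      using csubspace_diff[OF M B csubspace_scaleC[OF M]] by blast
    then show ?case
      using Suc intertwines by (simp add: cblinop_diff[OF R] cblinop_scaleC[OF R])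
  qed (simp add: x)
  then show ?thesis ..
qed

lemma intertwining_imp_common_eigenvalue:
  assumes R: "cblinop R" and M: "csubspace M" and B: "\<And>x. x \<in> M \<Longrightarrow> B x \<in> M"
    and intertwines: "\<And>x. x \<in> M \<Longrightarrow> R (B x) = A (R x)"
    and gen: "gen_root_system M B" and "z \<in> M" "R z \<noteq> 0"
  shows "psp_on M B \<inter> psp A \<noteq> {}"
proof -
  obtain l j x where l: "l \<in> psp_on M B" and x: "x \<in> M" "((\<lambda>y. B y - scaleC l y) ^^ j) x = 0" "R x \<noteq> 0"
    using gen_root_system_eq_0[OF gen R _ \<open>z \<in> M\<close>] \<open>R z \<noteq> 0\<close> by blast
  have "((\<lambda>y. A y - scaleC l y) ^^ j) (R x) = R 0"
    using intertwining_funpow_diff[where B = B and A = A, OF R M B intertwines x(1)] x(2) by metis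
  then have "l \<in> psp A"
    using eigenvalue_if_root_vector x(3) cblinop_0[OF R] by metis
  then show ?thesis
    using l by blast
qed

lemma cadj_commutant_intertwines_sub_adj:
  fixes T :: "'a::chilbert \<Rightarrow> 'a"
  assumes T: "cblinop T" and M: "csubspace M" "closed M" and S: "\<And>x. x \<in> M \<Longrightarrow> S x = T x"
    and C: "C \<in> commutant T" "range C \<subseteq> M" and x: "x \<in> M"
  shows "cadj C (sub_adj M S x) = cadj T (cadj C x)"
proof (rule cinner_ext_right)
  fix z
  note linC = commutant_cblinop[OF C(1)]
  have "cinner (C z) (cadj T x - cproj M (cadj T x)) = 0"
    using C(2) by (intro cproj_orthogonal M) blast
  then show "cinner z (cadj C (sub_adj M S x)) = cinner z (cadj T (cadj C x))"
    by (simp add: sub_adj_eq_cproj_cadj[OF M T S x] cinner_diff_right cinner_cadj_right[OF T]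
        cinner_cadj_right[OF linC] commutantD[OF C(1)])
qed

lemma T00_eq: "contraction T \<Longrightarrow> x \<in> H0 T \<Longrightarrow> T00 T x = T x"
  by (simp add: T00_def cproj_ident csubspace_H0 H0_invariant)

lemma eigenvector_in_H0_iff:
  assumes T: "cblinop T" and x: "x \<noteq> 0" "T x = scaleC l x"
  shows "x \<in> H0 T \<longleftrightarrow> norm l < 1"
proof -
  have "(T ^^ n) x = scaleC (l ^ n) x" for n
    by (induction n) (simp_all add: scaleC_one cblinop_scaleC[OF T] x(2) scaleC_scaleC mult.commute)
  then have norm: "norm ((T ^^ n) x) = norm l ^ n * norm x" for n
    by (simp add: norm_scaleC norm_power)
  have "x \<in> H0 T \<longleftrightarrow> (\<lambda>n. norm l ^ n * norm x) \<longlonglongrightarrow> 0"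
    unfolding H0_def mem_Collect_eq norm[symmetric] tendsto_norm_zero_iff ..
  also have "\<dots> \<longleftrightarrow> (\<lambda>n. norm l ^ n) \<longlonglongrightarrow> 0"
    using x(1) tendsto_mult_right_iff[of "norm x" "\<lambda>n. norm l ^ n" 0] by simp
  also have "\<dots> \<longleftrightarrow> norm l < 1"
  proof
    assume lim: "(\<lambda>n. norm l ^ n) \<longlonglongrightarrow> 0"
    show "norm l < 1"
    proof (rule ccontr)
      assume "\<not> norm l < 1"
      then have "1 \<le> (0::real)"
        by (intro LIMSEQ_le_const[OF lim]) (simp add: one_le_power)
      then show False
        by simp
    qed
  qed (simp add: LIMSEQ_power_zero)
  finally show ?thesis .
qed

lemma rank_one_in_commutant:
  fixes T :: "'a::chilbert \<Rightarrow> 'a"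
  assumes T: "cblinop T" and x: "T x = scaleC l x" and y: "cadj T y = scaleC (cnj l) y"
  shows "(\<lambda>z. scaleC (cinner y z) x) \<in> commutant T"
proof (rule commutantI)
  show "cblinop (\<lambda>z. scaleC (cinner y z) x)"
  proof (rule cblinopI[where K = "norm y * norm x"])
    show "norm (scaleC (cinner y z) x) \<le> norm y * norm x * norm z" for z
      using mult_right_mono[OF norm_cinner_le[of y z] norm_ge_zero[of x]]
      by (simp add: norm_scaleC mult_ac)
  qed (auto simp: cinner_simps scaleC_add_left scaleC_scaleC)
  show "scaleC (cinner y (T z)) x = T (scaleC (cinner y z) x)" for z
    by (simp add: y cinner_scaleC_left cblinop_scaleC[OF T] x scaleC_scaleC mult.commute
        flip: cinner_cadj_left[OF T])
qed

lemma common_eigenvalue_imp_commutant_into_H0: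
  fixes T :: "'a::chilbert \<Rightarrow> 'a"
  assumes T: "cblinop T" and l: "l \<in> psp T" "cnj l \<in> psp (cadj T)" "norm l < 1"
  shows "\<exists>C\<in>commutant T. range C \<subseteq> H0 T \<and> C \<noteq> (\<lambda>x. 0)"
proof -
  obtain x y where x: "x \<noteq> 0" "T x = scaleC l x" and y: "y \<noteq> 0" "cadj T y = scaleC (cnj l) y"
    using l(1,2) unfolding psp_on_iff by blast
  let ?C = "\<lambda>z. scaleC (cinner y z) x"
  have C: "?C \<in> commutant T"
    by (rule rank_one_in_commutant[OF T x(2) y(2)])
  have "scaleC c x \<in> H0 T" for c
  proof (cases "scaleC c x = 0")
    case True
    have "(T ^^ n) 0 = 0" for n
      by (rule cblinop_0[OF cblinop_funpow[OF T]])
    then show ?thesis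
      by (simp add: True H0_def)
  next
    case False
    then show ?thesis
      using l(3) eigenvector_in_H0_iff[OF T False, of l]
      by (simp add: cblinop_scaleC[OF T] x(2) scaleC_scaleC mult.commute)
  qed
  moreover have "norm (?C y) \<noteq> 0"
    unfolding norm_scaleC using x(1) y(1) by simp
  then have "?C \<noteq> (\<lambda>z. 0)"
    by (metis norm_zero)
  ultimately show ?thesis
    using C by (intro bexI[of _ ?C]) auto
qed

lemma commutant_into_H0_imp_common_eigenvalue:
  fixes T :: "'a::chilbert \<Rightarrow> 'a"
  assumes T: "contraction T"
    and spec: "psp_on (H0 T) (sub_adj (H0 T) (T00 T)) \<subseteq> cnj ` psp_on (H0 T) (T00 T)"
    and gen: "gen_root_system (H0 T) (sub_adj (H0 T) (T00 T))"
    and C: "C \<in> commutant T" "range C \<subseteq> H0 T" "C \<noteq> (\<lambda>x. 0)"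
  shows "\<exists>l. l \<in> psp T \<and> cnj l \<in> psp (cadj T) \<and> norm l < 1"
proof -
  let ?B = "sub_adj (H0 T) (T00 T)"
  note lin = contraction_cblinop[OF T] and M = csubspace_H0[OF T] closed_H0[OF T]
  note linC = commutant_cblinop[OF C(1)]
  have B_in: "?B x \<in> H0 T" if "x \<in> H0 T" for x
    using that by (simp add: sub_adj_eq_cproj_cadj[OF M lin] T00_eq[OF T] cproj_in[OF M])
  obtain z where "C z \<noteq> 0"
    using C(3) by blast
  then have "cadj C (C z) \<noteq> 0"
    using cinner_cadj_right[OF linC, of z "C z"] cinner_self_eq_0[of "C z"] cinner_zero_right[of z]
    by metis
  have "psp_on (H0 T) ?B \<inter> psp (cadj T) \<noteq> {}"
  proof (rule intertwining_imp_common_eigenvalue[OF cblinop_cadj[OF linC] M(1) _ _ gen])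
    show "cadj C (?B x) = cadj T (cadj C x)" if "x \<in> H0 T" for x
      using cadj_commutant_intertwines_sub_adj[OF lin M _ C(1,2) that] T00_eq[OF T] by blast
    show "C z \<in> H0 T"
      using C(2) by blast
  qed (use B_in \<open>cadj C (C z) \<noteq> 0\<close> in auto)
  then obtain k where k: "k \<in> psp_on (H0 T) ?B" "k \<in> psp (cadj T)"
    by blast
  then obtain l where l: "k = cnj l" "l \<in> psp_on (H0 T) (T00 T)"
    using spec by blast
  then obtain v where v: "v \<in> H0 T" "v \<noteq> 0" "T v = scaleC l v"
    using T00_eq[OF T] by (auto simp: psp_on_iff)
  then have "l \<in> psp T" "norm l < 1"
    using eigenvector_in_H0_iff[OF lin v(2,3)] by (auto simp: psp_on_iff)
  then show ?thesis
    using k(2) l(1) by blast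
qed

theorem mainTheorem13:
  fixes T :: "'a::chilbert \<Rightarrow> 'a" and J :: "'a \<Rightarrow> 'b::chilbert" and W :: "'b \<Rightarrow> 'b"
  assumes "contraction T"
    and "psp_on (H0 T) (sub_adj (H0 T) (T00 T)) \<subseteq> cnj ` psp_on (H0 T) (T00 T)"
    and "gen_root_system (H0 T) (sub_adj (H0 T) (T00 T))"
    and "min_unitary_dilation (RT T) (VT T) J W"
  shows "inj_on (gammaT T J W) (commutant T) \<longleftrightarrow>
         psp T \<inter> cnj ` psp (cadj T) \<inter> ball 0 1 = {}"
proof -
  interpret dilated_contraction T J W
    using assms(1,4) by unfold_locales
  have "inj_on (gammaT T J W) (commutant T) \<longleftrightarrow>
      \<not> (\<exists>C\<in>commutant T. range C \<subseteq> H0 T \<and> C \<noteq> (\<lambda>x. 0))"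
    unfolding inj_gammaT_iff by blast
  also have "\<dots> \<longleftrightarrow> \<not> (\<exists>l. l \<in> psp T \<and> cnj l \<in> psp (cadj T) \<and> norm l < 1)"
    using common_eigenvalue_imp_commutant_into_H0[OF contraction_cblinop[OF assms(1)]]
      commutant_into_H0_imp_common_eigenvalue[OF assms(1-3)] by blast
  also have "\<dots> \<longleftrightarrow> psp T \<inter> cnj ` psp (cadj T) \<inter> ball 0 1 = {}"
  proof -
    have "cnj l \<in> A \<longleftrightarrow> l \<in> cnj ` A" for l A
      by (metis complex_cnj_cnj imageE imageI)
    then show ?thesis
      by auto
  qed
  finally show ?thesis .
qed

end
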